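(* In type $A_{n-1}$, let $\lambda$ be a partition with at most $n-1$ parts, $\Gamma$ the $\lambda$-chain described below, $J\in\mathcal A(\lambda)$ an admissible subset, and $b=\mathrm{sfill}(J)\in B^{\otimes\lambda}$. For $i\in\{0,1,\dots,n-1\}$: there is a dual Demazure arrow $b\to f_i(b)$ if and only if $f_i(J)\neq\mathbf 0$, and in that case $f_i(b)=\mathrm{sfill}(f_i(J))$.
   Context: General quantum alcove model. Let $\Phi$ be an irreducible finite root system with inner product $\langle\cdot,\cdot\rangle$, positive roots $\Phi^+$, simple roots $\alpha_1,\dots,\alpha_r$, Weyl group $W$ with length $\ell$, highest root $\tilde\alpha$, $\rho=\frac12\sum_{\alpha\in\Phi^+}\alpha$, $\alpha^\vee=2\alpha/\langle\alpha,\alpha\rangle$, $s_\alpha$ the reflection, $\alpha_0:=\theta:=-\tilde\alpha$, $\mathrm{sgn}(\gamma)=\pm1$ according as $\gamma\in\Phi^+$ or not, $|\gamma|=\mathrm{sgn}(\gamma)\gamma$. Quantum Bruhat graph: edges $w\to ws_\beta$ ($\beta\in\Phi^+$) when $\ell(ws_\beta)=\ell(w)+1$ or $\ell(ws_\beta)=\ell(w)-2\langle\rho,\beta^\vee\rangle+1$. For a $\lambda$-chain $(\beta_1,\dots,\beta_m)$ let $r_i=s_{\beta_i}$, $l_i=\#\{j<i:\beta_j=\beta_i\}$, $\hat r_i=s_{\beta_i,-l_i}$ (affine reflection in $H_{\beta_i,-l_i}=\{x:\langle x,\beta_i^\vee\rangle=-l_i\}$). For $J=\{j_1<\dots<j_s\}\subseteq[m]$: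 $\gamma_k=r_{j_1}\cdots r_{j_p}(\beta_k)$ ($j_p$ the largest element of $J$ below $k$), $\gamma_\infty=r_{j_1}\cdots r_{j_s}(\rho)$, $l^\Delta_k$ defined by $H_{|\gamma_k|,-l^\Delta_k}=\hat r_{j_1}\cdots\hat r_{j_p}(H_{\beta_k,-l_k})$, $\mu(J)=-\hat r_{j_1}\cdots\hat r_{j_s}(-\lambda)$, $\varepsilon_k=1$ if $k\notin J$ and $-1$ if $k\in J$. $J$ is admissible if $1\xrightarrow{\beta_{j_1}}r_{j_1}\to r_{j_1}r_{j_2}\to\cdots\to r_{j_1}\cdots r_{j_s}$ is a path in the quantum Bruhat graph; $\mathcal A(\lambda)$ is the set of admissible subsets. For a root $\alpha$: $I_\alpha=\{i:\gamma_i=\pm\alpha\}=\{i_1<\dots<i_n\}$, $\hat I_\alpha=I_\alpha\cup\{\infty\}$, $l^\Delta_\infty:=\langle\mu(J),\mathrm{sgn}(\alpha)\alpha^\vee\rangle$; for $\alpha>0$, $g_\alpha$ on $[0,n+\frac12]$ is continuous piecewise-linear with $g_\alpha(0)=-\frac12$, slope $\mathrm{sgn}(\gamma_{i_k})$ on $(k-1,k-\frac12)$, $\varepsilon_{i_k}\mathrm{sgn}(\gamma_{i_k})$ on $(k-\frac12,k)$, $\mathrm{sgn}\langle\gamma_\infty,\alpha^\vee\rangle$ on $(n,n+\frac12)$; $g_\alpha=-g_{-\alpha}$ for $\alpha<0$ (known: $\mathrm{sgn}(\alpha)l^\Delta_{i_k}=g_\alpha(k-\frac12)$). Crystal operator $f_p$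 on admissible $J$: $M=\max g_{\alpha_p}$; $m$ the minimal $i\in\hat I_{\alpha_p}$ with $\mathrm{sgn}(\alpha_p)l^\Delta_i=M$; if $M>\delta_{p,0}$, $m$ has a predecessor $k$ in $\hat I_{\alpha_p}$ and $f_p(J)=(J\setminus\{m\})\cup\{k\}$ (with $J\setminus\{\infty\}=J\cup\{\infty\}=J$); otherwise $f_p(J)=\mathbf 0$. Type $A_{n-1}$: $V=\mathbb R^n/\mathbb R(1,\dots,1)$ with images $\varepsilon_1,\dots,\varepsilon_n$ of the coordinate vectors, roots $\alpha_{ij}=\varepsilon_i-\varepsilon_j$ ($i\neq j$), simple roots $\alpha_i=\alpha_{i,i+1}$, $\theta=\alpha_{n1}$, $W=S_n$ permuting coordinates; $(i,j)$ with $i<j$ denotes both $\alpha_{ij}$ and the transposition $t_{ij}$. $\lambda=(\lambda_1\ge\lambda_2\ge\dots)$ is a partition with at most $n-1$ parts, $\lambda'$ its conjugate. For $1\le k\le n-1$, $\Gamma(k)$ is the sequence $((k,k+1),(k,k+2),\dots,(k,n),(k-1,k+1),\dots,(k-1,n),\dots,(1,k+1),\dots,(1,n))$, and $\Gamma=\Gamma(\lambda'_1)\Gamma(\lambda'_2)\cdots\Gamma(\lambda'_{\lambda_1})$ (a $\lambda$-chain). For $J\subseteq[m]$ let $T^q$ be the sequence of roots $\beta_j$, $j\in J$, lying in the $q$-th factor $\Gamma(\lambda'_q)$, let $\pi_q\in S_n$ be the product (left to right) of the transpositions in $T^1,\dots,T^q$, let $C_q$ be the column with entries $\pi_q(1),\dots,\pi_q(\lambda'_q)$,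 $\mathrm{fill}(J)=C_1\cdots C_{\lambda_1}$, and $\mathrm{sfill}(J)$ the filling obtained by sorting each column increasingly. KR crystals: $B^{\otimes\lambda}=B^{\lambda'_1,1}\otimes\cdots\otimes B^{\lambda'_{\lambda_1},1}$ is the set of fillings of the Young diagram of $\lambda$ whose columns strictly increase with entries in $[n]$ (it is known that $\mathrm{sfill}$ is a bijection $\mathcal A(\lambda)\to B^{\otimes\lambda}$). The reading word of $b$ reads each column bottom to top, columns left to right. For $i\in\{1,\dots,n-1\}$ encode letters $i$ as $+$ and $i+1$ as $-$ (for $i=0$: $n$ as $+$, $1$ as $-$), ignore other letters, and repeatedly cancel adjacent pairs $-+$ until a word $+^x-^y$ remains. If $x>0$, $f_i(b)$ replaces the letter corresponding to the rightmost remaining $+$ by $i+1$ (for $i=0$: replaces that $n$ by $1$ and re-sorts the column); if $x=0$, $f_i(b)=\mathbf 0$. Set $\varphi_i(b)=x$. An arrow $b\to f_i(b)$ (with $f_i(b)\neq\mathbf 0$) is a dual Demazure arrow if $i\neq0$, or $i=0$ and $\varphi_0(b)\ge2$.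
   Formalization: For i=0 the letter 1 is read first in its column (so n and 1 in one column cancel) instead of bottom to top; read literally the claim fails: n=3, λ=(2,2), b=[2,3]|[1,3] has φ_0=2 and f_0 gives the column [1,1]. *)

theory Defs
  imports
    Complex_Main
    "HOL-Combinatorics.Combinatorics"
    "HOL-Library.Extended_Nat"
begin

section \<open>The root system of type \<open>A\<^sub>n\<^sub>-\<^sub>1\<close>\<close>

text \<open>
  A vector of \<open>V = R^n / R(1,...,1)\<close> is given by a representative in \<open>R^n\<close>, i.e. by a
  function on \<open>nat\<close> of which only the coordinates \<open>1..n\<close> matter; a subset of \<open>V\<close> is given by
  its preimage in \<open>R^n\<close>.  Roots have coordinate sum zero, so pairing with a coroot does not
  depend on the representative.  The root \<open>\<alpha>\<^sub>i\<^sub>j = \<epsilon>\<^sub>i - \<epsilon>\<^sub>j\<close> is the pair \<open>(i, j)\<close>.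
  Elements of \<open>W = S\<^sub>n\<close> are functions permuting \<open>{1..n}\<close>, multiplied by composition.
\<close>

type_synonym vec = "nat \<Rightarrow> real"
type_synonym root = "nat \<times> nat"
type_synonym perm = "nat \<Rightarrow> nat"

definition carrier_vec :: "nat \<Rightarrow> vec set" where
  "carrier_vec n = {x. \<forall>a. a \<notin> {1..n} \<longrightarrow> x a = 0}"

definition ip :: "nat \<Rightarrow> vec \<Rightarrow> vec \<Rightarrow> real" where
  "ip n x y = (\<Sum>a=1..n. x a * y a)"

definition root_vec :: "root \<Rightarrow> vec" where
  "root_vec \<beta> = (\<lambda>a. of_bool (a = fst \<beta>) - of_bool (a = snd \<beta>))"

text \<open>\<open>\<langle>x, \<beta>\<^sup>\<or>\<rangle>\<close> with \<open>\<beta>\<^sup>\<or> = 2 \<beta> / \<langle>\<beta>, \<beta>\<rangle>\<close>.\<close>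

definition coroot_pairing :: "nat \<Rightarrow> vec \<Rightarrow> root \<Rightarrow> real" where
  "coroot_pairing n x \<beta> = ip n x (\<lambda>a. 2 * root_vec \<beta> a / ip n (root_vec \<beta>) (root_vec \<beta>))"

definition pos_roots :: "nat \<Rightarrow> root set" where
  "pos_roots n = {(a, b). 1 \<le> a \<and> a < b \<and> b \<le> n}"

definition neg_root :: "root \<Rightarrow> root" where
  "neg_root \<gamma> = (snd \<gamma>, fst \<gamma>)"

definition sgn_root :: "nat \<Rightarrow> root \<Rightarrow> int" where
  "sgn_root n \<gamma> = (if \<gamma> \<in> pos_roots n then 1 else - 1)"

definition abs_root :: "nat \<Rightarrow> root \<Rightarrow> root" where
  "abs_root n \<gamma> = (if \<gamma> \<in> pos_roots n then \<gamma> else neg_root \<gamma>)"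

definition rho :: "nat \<Rightarrow> vec" where
  "rho n = (\<lambda>a. (\<Sum>\<beta>\<in>pos_roots n. root_vec \<beta> a) / 2)"

text \<open>\<open>\<alpha>\<^sub>p\<close> for \<open>p \<in> {0..n-1}\<close>, with \<open>\<alpha>\<^sub>0 = \<theta> = \<alpha>\<^sub>n\<^sub>1\<close>.\<close>

definition alpha :: "nat \<Rightarrow> nat \<Rightarrow> root" where
  "alpha n p = (if p = 0 then (n, 1) else (p, Suc p))"

definition refl_perm :: "root \<Rightarrow> perm" where
  "refl_perm \<beta> = Transposition.transpose (fst \<beta>) (snd \<beta>)"

definition prod_refl :: "root list \<Rightarrow> perm" where
  "prod_refl \<beta>s = foldr (\<lambda>\<beta> w. refl_perm \<beta> \<circ> w) \<beta>s id"

definition act_root :: "perm \<Rightarrow> root \<Rightarrow> root" where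
  "act_root w \<beta> = (w (fst \<beta>), w (snd \<beta>))"

text \<open>\<open>w\<close> sends the coordinate vector \<open>\<epsilon>\<^sub>a\<close> to \<open>\<epsilon>\<close> with index \<open>w a\<close>.\<close>

definition act_vec :: "perm \<Rightarrow> vec \<Rightarrow> vec" where
  "act_vec w x = (\<lambda>a. x (inv w a))"

definition weyl_length :: "nat \<Rightarrow> perm \<Rightarrow> nat" where
  "weyl_length n w =
     (LEAST k. \<exists>ps. length ps = k \<and> set ps \<subseteq> {1..<n} \<and> w = prod_refl (map (alpha n) ps))"

definition qbg_edge :: "nat \<Rightarrow> perm \<Rightarrow> root \<Rightarrow> perm \<Rightarrow> bool" where
  "qbg_edge n w \<beta> v \<longleftrightarrow>
     w permutes {1..n} \<and> \<beta> \<in> pos_roots n \<and> v = w \<circ> refl_perm \<beta> \<and>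
     (weyl_length n v = weyl_length n w + 1 \<or>
      real (weyl_length n v) = real (weyl_length n w) - 2 * coroot_pairing n (rho n) \<beta> + 1)"

definition hyperplane :: "nat \<Rightarrow> root \<Rightarrow> int \<Rightarrow> vec set" where
  "hyperplane n \<beta> k = {x \<in> carrier_vec n. coroot_pairing n x \<beta> = of_int k}"

definition aff_refl :: "nat \<Rightarrow> root \<Rightarrow> int \<Rightarrow> vec \<Rightarrow> vec" where
  "aff_refl n \<beta> k x = (\<lambda>a. x a - (coroot_pairing n x \<beta> - of_int k) * root_vec \<beta> a)"

section \<open>The quantum alcove model\<close>

text \<open>
  \<open>B\<close> is a \<open>\<lambda>\<close>-chain and \<open>lam\<close> is the vector \<open>\<lambda>\<close>.  Positions in \<open>B\<close> are counted from 1.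
\<close>

definition chain_root :: "root list \<Rightarrow> nat \<Rightarrow> root" where
  "chain_root B k = B ! (k - 1)"

definition chain_level :: "root list \<Rightarrow> nat \<Rightarrow> nat" where
  "chain_level B k = card {j. 1 \<le> j \<and> j < k \<and> chain_root B j = chain_root B k}"

definition refl_upto :: "root list \<Rightarrow> nat set \<Rightarrow> perm" where
  "refl_upto B J = prod_refl (map (chain_root B) (sorted_list_of_set J))"

definition aff_refl_upto :: "nat \<Rightarrow> root list \<Rightarrow> nat set \<Rightarrow> vec \<Rightarrow> vec" where
  "aff_refl_upto n B J =
     foldr (\<lambda>j f. aff_refl n (chain_root B j) (- int (chain_level B j)) \<circ> f)
       (sorted_list_of_set J) id"

definition gamma_root :: "root list \<Rightarrow> nat set \<Rightarrow> nat \<Rightarrow> root" where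
  "gamma_root B J k = act_root (refl_upto B {j \<in> J. j < k}) (chain_root B k)"

definition gamma_inf :: "nat \<Rightarrow> root list \<Rightarrow> nat set \<Rightarrow> vec" where
  "gamma_inf n B J = act_vec (refl_upto B J) (rho n)"

definition mu :: "nat \<Rightarrow> root list \<Rightarrow> vec \<Rightarrow> nat set \<Rightarrow> vec" where
  "mu n B lam J = (\<lambda>a. - aff_refl_upto n B J (\<lambda>c. - lam c) a)"

definition level_Delta :: "nat \<Rightarrow> root list \<Rightarrow> nat set \<Rightarrow> nat \<Rightarrow> int" where
  "level_Delta n B J k =
     (THE l. hyperplane n (abs_root n (gamma_root B J k)) (- l) =
             aff_refl_upto n B {j \<in> J. j < k} `
               hyperplane n (chain_root B k) (- int (chain_level B k)))"

definition admissible :: "nat \<Rightarrow> root list \<Rightarrow> nat set set" where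
  "admissible n B =
     {J. J \<subseteq> {1..length B} \<and>
         (let \<beta>s = map (chain_root B) (sorted_list_of_set J)
          in \<forall>p < length \<beta>s.
               qbg_edge n (prod_refl (take p \<beta>s)) (\<beta>s ! p) (prod_refl (take (Suc p) \<beta>s)))}"

definition I_set :: "root list \<Rightarrow> nat set \<Rightarrow> root \<Rightarrow> nat set" where
  "I_set B J \<alpha> =
     {k \<in> {1..length B}. gamma_root B J k = \<alpha> \<or> gamma_root B J k = neg_root \<alpha>}"

definition I_hat :: "root list \<Rightarrow> nat set \<Rightarrow> root \<Rightarrow> enat set" where
  "I_hat B J \<alpha> = enat ` I_set B J \<alpha> \<union> {\<infinity>}"

definition level_Delta_hat :: "nat \<Rightarrow> root list \<Rightarrow> vec \<Rightarrow> nat set \<Rightarrow> root \<Rightarrow> enat \<Rightarrow> real" where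
  "level_Delta_hat n B lam J \<alpha> k =
     (case k of
        enat k' \<Rightarrow> of_int (level_Delta n B J k')
      | \<infinity> \<Rightarrow> of_int (sgn_root n \<alpha>) * coroot_pairing n (mu n B lam J) \<alpha>)"

text \<open>The slope of \<open>g\<^sub>\<alpha>\<close>, \<open>\<alpha> > 0\<close>, on the interval from \<open>j/2\<close> to \<open>(j+1)/2\<close>, for \<open>j \<le> 2 |I\<^sub>\<alpha>|\<close>.\<close>

definition g_slope :: "nat \<Rightarrow> root list \<Rightarrow> nat set \<Rightarrow> root \<Rightarrow> nat \<Rightarrow> real" where
  "g_slope n B J \<alpha> j =
     (if j = 2 * card (I_set B J \<alpha>) then sgn (coroot_pairing n (gamma_inf n B J) \<alpha>)
      else
        let i = sorted_list_of_set (I_set B J \<alpha>) ! (j div 2);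
            s = of_int (sgn_root n (gamma_root B J i))
        in if even j then s else (if i \<in> J then - 1 else 1) * s)"

text \<open>
  The \<open>j\<close>-th summand of \<open>g_pos\<close> is constant outside the interval from \<open>j/2\<close> to \<open>(j+1)/2\<close> and
  has slope \<open>g_slope n B J \<alpha> j\<close> on it.
\<close>

definition g_pos :: "nat \<Rightarrow> root list \<Rightarrow> nat set \<Rightarrow> root \<Rightarrow> real \<Rightarrow> real" where
  "g_pos n B J \<alpha> x =
     - 1 / 2 + (\<Sum>j = 0..2 * card (I_set B J \<alpha>).
                  g_slope n B J \<alpha> j * max 0 (min (x - real j / 2) (1 / 2)))"

definition g_fun :: "nat \<Rightarrow> root list \<Rightarrow> nat set \<Rightarrow> root \<Rightarrow> real \<Rightarrow> real" where
  "g_fun n B J \<alpha> x =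
     (if \<alpha> \<in> pos_roots n then g_pos n B J \<alpha> x else - g_pos n B J (neg_root \<alpha>) x)"

text \<open>The supremum is a maximum, because \<open>g\<^sub>\<alpha>\<close> is continuous on a compact interval.\<close>

definition g_max :: "nat \<Rightarrow> root list \<Rightarrow> nat set \<Rightarrow> root \<Rightarrow> real" where
  "g_max n B J \<alpha> = (SUP x \<in> {0..real (card (I_set B J \<alpha>)) + 1 / 2}. g_fun n B J \<alpha> x)"

text \<open>
  \<open>None\<close> stands for \<open>\<zero>\<close>.  Removing \<open>m\<close> from \<open>J\<close> has no effect if \<open>m = \<infinity>\<close>; the predecessor
  of \<open>m\<close> is always finite.
\<close>

definition alcove_f :: "nat \<Rightarrow> root list \<Rightarrow> vec \<Rightarrow> nat \<Rightarrow> nat set \<Rightarrow> nat set option" where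
  "alcove_f n B lam p J =
     (let \<alpha> = alpha n p;
          M = g_max n B J \<alpha>;
          m = (LEAST i. i \<in> I_hat B J \<alpha> \<and>
                 of_int (sgn_root n \<alpha>) * level_Delta_hat n B lam J \<alpha> i = M);
          k = Max {i \<in> I_set B J \<alpha>. enat i < m}
      in if M > of_bool (p = 0) then Some ({j \<in> J. enat j \<noteq> m} \<union> {k}) else None)"

section \<open>Partitions, the chain \<open>\<Gamma>\<close> and the filling map\<close>

text \<open>A partition is a function of which only the values at positive arguments matter.\<close>

definition partition_below :: "nat \<Rightarrow> (nat \<Rightarrow> nat) \<Rightarrow> bool" where
  "partition_below n lam \<longleftrightarrow>
     (\<forall>i\<ge>1. lam (Suc i) \<le> lam i) \<and> (\<forall>i. 1 \<le> i \<and> n \<le> i \<longrightarrow> lam i = 0)"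

definition conj_part :: "(nat \<Rightarrow> nat) \<Rightarrow> nat \<Rightarrow> nat" where
  "conj_part lam q = card {i. 1 \<le> i \<and> q \<le> lam i}"

definition weight_vec :: "nat \<Rightarrow> (nat \<Rightarrow> nat) \<Rightarrow> vec" where
  "weight_vec n lam = (\<lambda>a. if a \<in> {1..n} then real (lam a) else 0)"

definition Gamma_col :: "nat \<Rightarrow> nat \<Rightarrow> root list" where
  "Gamma_col n k = concat (map (\<lambda>a. map (\<lambda>b. (a, b)) [Suc k..<Suc n]) (rev [1..<Suc k]))"

text \<open>The concatenation of the first \<open>q\<close> factors of \<open>\<Gamma>\<close>.\<close>

definition Gamma_prefix :: "nat \<Rightarrow> (nat \<Rightarrow> nat) \<Rightarrow> nat \<Rightarrow> root list" where
  "Gamma_prefix n lam q = concat (map (\<lambda>c. Gamma_col n (conj_part lam c)) [1..<Suc q])"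

definition Gamma :: "nat \<Rightarrow> (nat \<Rightarrow> nat) \<Rightarrow> root list" where
  "Gamma n lam = Gamma_prefix n lam (lam 1)"

text \<open>The sequence \<open>T\<^sup>q\<close>, \<open>q \<ge> 1\<close>; \<open>nths\<close> counts from 0 whereas \<open>J\<close> counts from 1.\<close>

definition T_seq :: "nat \<Rightarrow> (nat \<Rightarrow> nat) \<Rightarrow> nat set \<Rightarrow> nat \<Rightarrow> root list" where
  "T_seq n lam J q =
     nths (Gamma_col n (conj_part lam q))
       {p. Suc (length (Gamma_prefix n lam (q - 1)) + p) \<in> J}"

definition fill_perm :: "nat \<Rightarrow> (nat \<Rightarrow> nat) \<Rightarrow> nat set \<Rightarrow> nat \<Rightarrow> perm" where
  "fill_perm n lam J q = prod_refl (concat (map (T_seq n lam J) [1..<Suc q]))"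

text \<open>A filling is the list of its columns, each one read from top to bottom.\<close>

type_synonym filling = "nat list list"

definition fill :: "nat \<Rightarrow> (nat \<Rightarrow> nat) \<Rightarrow> nat set \<Rightarrow> filling" where
  "fill n lam J =
     map (\<lambda>q. map (fill_perm n lam J q) [1..<Suc (conj_part lam q)]) [1..<Suc (lam 1)]"

definition sfill :: "nat \<Rightarrow> (nat \<Rightarrow> nat) \<Rightarrow> nat set \<Rightarrow> filling" where
  "sfill n lam J = map sort (fill n lam J)"

section \<open>Tensor products of column shape Kirillov-Reshetikhin crystals\<close>

definition KR_crystal :: "nat \<Rightarrow> (nat \<Rightarrow> nat) \<Rightarrow> filling set" where
  "KR_crystal n lam =
     {b. length b = lam 1 \<and>
         (\<forall>q < lam 1. length (b ! q) = conj_part lam (Suc q) \<and>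
            sorted_wrt (<) (b ! q) \<and> set (b ! q) \<subseteq> {1..n})}"

definition plus_letter :: "nat \<Rightarrow> nat \<Rightarrow> nat" where
  "plus_letter n i = (if i = 0 then n else i)"

definition minus_letter :: "nat \<Rightarrow> nat" where
  "minus_letter i = Suc i"

text \<open>
  Columns are read from bottom to top.  For \<open>i = 0\<close> the letter 1 plays the role of the successor
  of \<open>n\<close>, so it is read first in its column, as is \<open>i + 1\<close> before \<open>i\<close> in the case \<open>i > 0\<close>.
  Hence \<open>n\<close> and \<open>1\<close> in one column cancel, in accordance with \<open>f\<^sub>0\<close> being conjugate to \<open>f\<^sub>1\<close>
  under promotion.  If \<open>n\<close> were read before 1, \<open>f\<^sub>0\<close> could produce a column with two entries 1.
\<close>

definition column_word :: "nat \<Rightarrow> nat list \<Rightarrow> nat list" where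
  "column_word i c =
     (if i = 0 then filter (\<lambda>a. a = 1) c @ rev (filter (\<lambda>a. a \<noteq> 1) c) else rev c)"

datatype sign = Plus | Minus

text \<open>Every sign is tagged with the index, counted from 0, of the column it comes from.\<close>

definition signature_word :: "nat \<Rightarrow> nat \<Rightarrow> filling \<Rightarrow> (sign \<times> nat) list" where
  "signature_word n i b =
     concat (map (\<lambda>q. map (\<lambda>a. (if a = plus_letter n i then Plus else Minus, q))
                        (filter (\<lambda>a. a \<in> {plus_letter n i, minus_letter i})
                           (column_word i (b ! q))))
               [0..<length b])"

inductive cancel_step :: "(sign \<times> 'a) list \<Rightarrow> (sign \<times> 'a) list \<Rightarrow> bool" where
  "cancel_step (u @ [(Minus, a), (Plus, c)] @ v) (u @ v)"

text \<open>The word that remains after all cancellations; see the lemmas that follow.\<close>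

fun cancel_cons :: "sign \<times> 'a \<Rightarrow> (sign \<times> 'a) list \<Rightarrow> (sign \<times> 'a) list" where
  "cancel_cons (Minus, a) ((Plus, c) # w) = w"
| "cancel_cons x w = x # w"

definition reduced_word :: "(sign \<times> 'a) list \<Rightarrow> (sign \<times> 'a) list" where
  "reduced_word w = foldr cancel_cons w []"

lemma reduced_word_reachable: "cancel_step\<^sup>*\<^sup>* w (reduced_word w)"
proof (induction w)
  case Nil
  then show ?case by (simp add: reduced_word_def)
next
  case (Cons x w)
  have cons: "cancel_step\<^sup>*\<^sup>* (x # u) (x # v)" if "cancel_step\<^sup>*\<^sup>* u v" for u v
    using that
  proof (induction rule: rtranclp_induct)
    case base
    then show ?case by simp
  next
    case (step y z)
    from step.hyps(2) have "cancel_step (x # y) (x # z)"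
      by (cases rule: cancel_step.cases)
        (metis append_Cons cancel_step.intros)
    with step.IH show ?case by (rule rtranclp.rtrancl_into_rtrancl)
  qed
  have "cancel_step\<^sup>*\<^sup>* (x # v) (cancel_cons x v)" for v
    by (cases "(x, v)" rule: cancel_cons.cases)
      (auto intro: r_into_rtranclp cancel_step.intros[of "[]", simplified])
  with cons[OF Cons.IH] show ?case
    by (auto simp: reduced_word_def intro: rtranclp_trans)
qed

lemma reduced_word_normal:
  "\<exists>x y. map fst (reduced_word w) = replicate x Plus @ replicate y Minus"
proof (induction w)
  case Nil
  then show ?case by (simp add: reduced_word_def)
next
  case (Cons s w)
  then obtain x y where xy: "map fst (reduced_word w) = replicate x Plus @ replicate y Minus"
    by blast
  obtain t a where s: "s = (t, a)"
    by (cases s)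
  have red: "reduced_word (s # w) = cancel_cons (t, a) (reduced_word w)"
    by (simp add: reduced_word_def s)
  show ?case
  proof (cases t)
    case Plus
    with red xy have "map fst (reduced_word (s # w)) = replicate (Suc x) Plus @ replicate y Minus"
      by simp
    then show ?thesis by blast
  next
    case Minus
    show ?thesis
    proof (cases x)
      case 0
      with xy have "cancel_cons (Minus, a) (reduced_word w) = (Minus, a) # reduced_word w"
        by (cases "((Minus, a), reduced_word w)" rule: cancel_cons.cases) (cases y; auto)+
      with 0 xy red Minus
      have "map fst (reduced_word (s # w)) = replicate 0 Plus @ replicate (Suc y) Minus"
        by simp
      then show ?thesis by blast
    next
      case (Suc x')
      with xy obtain c v where "reduced_word w = (Plus, c) # v"
        by (cases "reduced_word w") auto
      with xy Suc red Minus
      have "map fst (reduced_word (s # w)) = replicate x' Plus @ replicate y Minus"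
        by simp
      then show ?thesis by blast
    qed
  qed
qed

definition remaining_plus :: "nat \<Rightarrow> nat \<Rightarrow> filling \<Rightarrow> (sign \<times> nat) list" where
  "remaining_plus n i b = filter (\<lambda>(s, q). s = Plus) (reduced_word (signature_word n i b))"

definition KR_phi :: "nat \<Rightarrow> nat \<Rightarrow> filling \<Rightarrow> nat" where
  "KR_phi n i b = length (remaining_plus n i b)"

text \<open>
  Letters in a column are distinct, so the column of the rightmost remaining \<open>+\<close> determines the
  letter to be replaced.
\<close>

definition KR_f :: "nat \<Rightarrow> nat \<Rightarrow> filling \<Rightarrow> filling option" where
  "KR_f n i b =
     (if KR_phi n i b = 0 then None
      else
        let q = snd (last (remaining_plus n i b));
            c = map (\<lambda>a. if a = plus_letter n i then minus_letter i else a) (b ! q)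
        in Some (b[q := if i = 0 then sort c else c]))"

definition dual_Demazure_arrow :: "nat \<Rightarrow> (nat \<Rightarrow> nat) \<Rightarrow> nat \<Rightarrow> filling \<Rightarrow> filling \<Rightarrow> bool" where
  "dual_Demazure_arrow n lam i b c \<longleftrightarrow>
     b \<in> KR_crystal n lam \<and> KR_f n i b = Some c \<and> (i \<noteq> 0 \<or> KR_phi n 0 b \<ge> 2)"

end

theory Submission
  imports Defs
begin

text \<open>
  Let \<open>h\<^sub>q = \<langle>content of the first q columns, \<alpha>\<^sub>i\<rangle>\<close>.  The signature rule gives \<open>\<phi>\<^sub>i(b) = max h\<^sub>q\<close>, and \<open>f\<^sub>i\<close>
  acts on the first column where this maximum is attained.  All hyperplanes of the factor of \<open>\<Gamma>\<close>
  for the column \<open>q + 1\<close> pass through one point, whose image under the folding is minus the content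
  of the first \<open>q\<close> columns.  Hence \<open>g\<^sub>\<alpha>\<close> takes the value \<open>h\<^sub>q\<close> at each \<open>k - 1/2\<close> belonging to that
  column, although the number of such \<open>k\<close> may be zero.

  The quantum Bruhat condition enters once: in \<open>w(1) \<dots> w(n)\<close> the order of the cyclically adjacent
  letters \<open>i\<close>, \<open>i + 1\<close> can change from \<open>i\<close> before \<open>i + 1\<close> to the opposite order only by
  exchanging these two letters.  So \<open>g\<^sub>\<alpha>\<close> has no peak between two elements of \<open>I\<^sub>\<alpha>\<close>, and
  \<open>max g\<^sub>\<alpha> = max h\<^sub>q\<close> once it exceeds the threshold.  Between the new folding at \<open>k\<close> and the old one at
  \<open>m\<close> all permutations get multiplied by the reflection in \<open>\<alpha>\<^sub>i\<close>; there \<open>h\<^sub>q\<close> stays at its maximum,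
  so that this changes the content of just one column, the first one to attain the maximum.
\<close>

section \<open>Pairings, \<rho> and products of reflections in coordinates\<close>

lemma coroot_pairing_eq:
  assumes "a \<noteq> b" "a \<in> {1..n}" "b \<in> {1..n}"
  shows "coroot_pairing n x (a, b) = x a - x b"
proof -
  have ip: "ip n z (\<lambda>c. r * root_vec (a, b) c) = r * (z a - z b)" for z r
  proof -
    have "ip n z (\<lambda>c. r * root_vec (a, b) c) =
        (\<Sum>c=1..n. (if c = a then r * z c else 0) - (if c = b then r * z c else 0))"
      unfolding ip_def root_vec_def by (intro sum.cong) (auto simp: algebra_simps)
    also have "\<dots> = r * (z a - z b)"
      using assms by (simp add: sum_subtractf algebra_simps)
    finally show ?thesis .
  qed
  have "ip n (root_vec (a, b)) (root_vec (a, b)) = 2"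
    using ip[of "root_vec (a, b)" 1] assms(1) by (simp add: root_vec_def)
  then show ?thesis
    using ip[of x 1] by (simp add: coroot_pairing_def)
qed

lemma finite_pos_roots: "finite (pos_roots n)"
  by (rule finite_subset[of _ "{1..n} \<times> {1..n}"]) (auto simp: pos_roots_def)

text \<open>Among the positive roots, \<open>n - a\<close> have first index \<open>a\<close> and
  \<open>a - 1\<close> have second index \<open>a\<close>; half the difference is the
  coordinate.\<close>

lemma rho_eq:
  assumes "a \<in> {1..n}"
  shows "rho n a = (real n + 1) / 2 - real a"
proof -
  have "(\<Sum>\<beta>\<in>pos_roots n. root_vec \<beta> a) =
      (\<Sum>\<beta>\<in>pos_roots n. of_bool (fst \<beta> = a)) - (\<Sum>\<beta>\<in>pos_roots n. of_bool (snd \<beta> = a))"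
    by (auto simp: root_vec_def sum_subtractf[symmetric] intro!: sum.cong)
  also have "\<dots> = real (card {\<beta> \<in> pos_roots n. fst \<beta> = a}) - card {\<beta> \<in> pos_roots n. snd \<beta> = a}"
    by (simp add: finite_pos_roots sum.If_cases of_bool_def Int_def)
  also have "{\<beta> \<in> pos_roots n. fst \<beta> = a} = Pair a ` {a<..n}"
    using assms by (auto simp: pos_roots_def)
  also have "{\<beta> \<in> pos_roots n. snd \<beta> = a} = (\<lambda>c. (c, a)) ` {1..<a}"
    using assms by (auto simp: pos_roots_def)
  also have "real (card (Pair a ` {a<..n})) - card ((\<lambda>c. (c, a)) ` {1..<a}) = real n + 1 - 2 * real a"
    using assms by (simp add: card_image inj_on_def of_nat_diff)
  finally show ?thesis
    by (simp add: rho_def field_simps)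
qed

lemma refl_perm_permutes:
  "\<beta> \<in> pos_roots n \<Longrightarrow> refl_perm \<beta> permutes {1..n}"
  by (auto simp: refl_perm_def pos_roots_def intro!: permutes_swap_id)

lemma prod_refl_Nil [simp]: "prod_refl [] = id"
  and prod_refl_Cons [simp]: "prod_refl (\<beta> # \<beta>s) = refl_perm \<beta> \<circ> prod_refl \<beta>s"
  by (simp_all add: prod_refl_def)

lemma prod_refl_append: "prod_refl (xs @ ys) = prod_refl xs \<circ> prod_refl ys"
  by (induction xs) (auto simp: o_assoc)

section \<open>Lengths and inversions\<close>

definition inversions :: "nat \<Rightarrow> perm \<Rightarrow> (nat \<times> nat) set" where
  "inversions n w = {(a, b). 1 \<le> a \<and> a < b \<and> b \<le> n \<and> w b < w a}"

lemma finite_inversions: "finite (inversions n w)"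
  by (rule finite_subset[OF _ finite_pos_roots[of n]]) (auto simp: pos_roots_def inversions_def)

text \<open>
  Apart from the pairs \<open>(a, b)\<close>, \<open>(a, e)\<close>, \<open>(e, b)\<close> with \<open>e \<in> E\<close>, the inversions of \<open>w t\<close>
  correspond to those of \<open>w\<close>: apply \<open>t\<close> to both members of a pair whenever this keeps their order.
\<close>

lemma card_inversions_swap:
  assumes w: "w permutes {1..n}" and ab: "1 \<le> a" "a < b" "b \<le> n" and up: "w a < w b"
  defines "E \<equiv> {c. a < c \<and> c < b \<and> w a < w c \<and> w c < w b}"
  shows "card (inversions n (w \<circ> Transposition.transpose a b)) = card (inversions n w) + 1 + 2 * card E"
proof -
  let ?t = "Transposition.transpose a b"
  let ?f = "\<lambda>(c, d). if ?t c < ?t d then (?t c, ?t d) else (c, d)"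
  let ?X = "insert (a, b) (Pair a ` E \<union> (\<lambda>e. (e, b)) ` E)"
  have inj: "inj w" using w by (rule permutes_inj)
  have t_in: "1 \<le> ?t c \<and> ?t c \<le> n" if "1 \<le> c" "c \<le> n" for c
    using that ab by (auto simp: transpose_def)
  have inj_f: "inj_on ?f (inversions n w)"
  proof (rule inj_onI, clarify)
    fix c d c' d'
    assume *: "(c, d) \<in> inversions n w" "(c', d') \<in> inversions n w"
      and eq: "(if ?t c < ?t d then (?t c, ?t d) else (c, d)) =
        (if ?t c' < ?t d' then (?t c', ?t d') else (c', d'))"
    have "c < d" "c' < d'" using * by (auto simp: inversions_def)
    then show "c = c' \<and> d = d'"
      using eq by (auto split: if_splits simp: transpose_eq_iff)
  qed
  have fin: "finite E" by (rule finite_subset[of _ "{..b}"]) (auto simp: E_def)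
  have disj: "?f ` inversions n w \<inter> ?X = {}"
    using up ab by (auto simp: inversions_def E_def transpose_def split: if_splits)
  have un: "inversions n (w \<circ> ?t) = ?f ` inversions n w \<union> ?X"
  proof (intro equalityI subsetI)
    fix p assume "p \<in> inversions n (w \<circ> ?t)"
    then obtain c d where p: "p = (c, d)" and cd: "1 \<le> c" "c < d" "d \<le> n" "w (?t d) < w (?t c)"
      by (auto simp: inversions_def)
    show "p \<in> ?f ` inversions n w \<union> ?X"
    proof (cases "?t c < ?t d")
      case True
      then have "(?t c, ?t d) \<in> inversions n w" "?f (?t c, ?t d) = p"
        using cd t_in[of c] t_in[of d] by (auto simp: inversions_def p)
      then show ?thesis by (intro UnI1) (rule image_eqI[of _ _ "(?t c, ?t d)"], simp_all only:)
    next
      case False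
      show ?thesis
      proof (cases "p \<in> ?X")
        case True then show ?thesis by blast
      next
        case nX: False
        have neq: "w c \<noteq> w a" if "c \<noteq> a" for c using inj that by (auto dest: injD)
        have neq': "w c \<noteq> w b" if "c \<noteq> b" for c using inj that by (auto dest: injD)
        \<comment> \<open>Here \<open>?t\<close> reverses the order of the pair, which is therefore
          \<open>(a, e)\<close> or \<open>(e, b)\<close> with \<open>e\<close> strictly between. As
          \<open>e\<close> is not in \<open>E\<close>, the value \<open>w e\<close> lies outside the
          interval from \<open>w a\<close> to \<open>w b\<close>, and the pair is already inverted
          by \<open>w\<close>.\<close>
        have "(c, d) \<in> inversions n w"
          using False cd nX ab neq[of d] neq[of c] neq'[of c] neq'[of d] up
          by (auto simp: inversions_def p E_def transpose_def split: if_splits)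
        moreover have "?f (c, d) = p" using False p by simp
        ultimately show ?thesis by (intro UnI1) (rule image_eqI[of _ _ "(c, d)"], simp_all only:)
      qed
    qed
  next
    fix p assume "p \<in> ?f ` inversions n w \<union> ?X"
    then show "p \<in> inversions n (w \<circ> ?t)"
    proof
      assume "p \<in> ?X"
      then show ?thesis using ab up by (auto simp: inversions_def E_def transpose_def)
    next
      assume "p \<in> ?f ` inversions n w"
      then obtain c d where cd: "1 \<le> c" "c < d" "d \<le> n" "w d < w c" and p: "p = ?f (c, d)"
        by (auto simp: inversions_def)
      show ?thesis
      proof (cases "?t c < ?t d")
        case True
        then show ?thesis using cd t_in[of c] t_in[of d] p by (auto simp: inversions_def)
      next
        case False
        then show ?thesis using cd p ab up
          by (auto simp: inversions_def transpose_def split: if_splits)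
      qed
    qed
  qed
  have "card ?X = 1 + 2 * card E"
  proof -
    have "(a, b) \<notin> Pair a ` E \<union> (\<lambda>e. (e, b)) ` E" "Pair a ` E \<inter> (\<lambda>e. (e, b)) ` E = {}"
      by (auto simp: E_def)
    then show ?thesis
      using fin by (simp add: card_Un_disjoint card_image inj_on_def)
  qed
  moreover have "card (?f ` inversions n w \<union> ?X) = card (?f ` inversions n w) + card ?X"
    using disj fin by (intro card_Un_disjoint) (simp_all add: finite_inversions)
  ultimately show ?thesis
    unfolding un card_image[OF inj_f] by linarith
qed

text \<open>Between adjacent positions \<open>E\<close> is empty. A descent of \<open>w\<close> is
  an ascent of \<open>w'\<close>, so the second claim is the first one with the two permutations
  exchanged.\<close>

lemma card_inversions_adjacent:
  assumes w: "w permutes {1..n}" and p: "p \<in> {1..<n}"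
  defines "w' \<equiv> w \<circ> Transposition.transpose p (Suc p)"
  shows "w p < w (Suc p) \<Longrightarrow> card (inversions n w') = card (inversions n w) + 1"
    and "w (Suc p) < w p \<Longrightarrow> card (inversions n w) = card (inversions n w') + 1"
proof -
  have E: "{c. p < c \<and> c < Suc p \<and> v p < v c \<and> v c < v (Suc p)} = {}" for v :: perm
    by auto
  show "w p < w (Suc p) \<Longrightarrow> card (inversions n w') = card (inversions n w) + 1"
    using card_inversions_swap[OF w, of p "Suc p"] p E[of w] by (auto simp: w'_def)
  have w': "w' permutes {1..n}"
    unfolding w'_def using w p by (intro permutes_compose permutes_swap_id) auto
  have "w' \<circ> Transposition.transpose p (Suc p) = w"
    by (auto simp: w'_def fun_eq_iff)
  then show "w (Suc p) < w p \<Longrightarrow> card (inversions n w) = card (inversions n w') + 1"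
    using card_inversions_swap[OF w', of p "Suc p"] p E[of w'] by (auto simp: w'_def)
qed

text \<open>Each further simple reflection adds at most one inversion, which bounds the length from
  below.\<close>

lemma card_inversions_word_le:
  assumes "set ps \<subseteq> {1..<n}"
  shows "prod_refl (map (alpha n) ps) permutes {1..n} \<and>
    card (inversions n (prod_refl (map (alpha n) ps))) \<le> length ps"
  using assms
proof (induction ps rule: rev_induct)
  case Nil
  have "inversions n id = {}" by (auto simp: inversions_def)
  then show ?case by (simp only: list.map prod_refl_Nil permutes_id) simp
next
  case (snoc p ps)
  let ?w = "prod_refl (map (alpha n) ps)"
  have p: "p \<in> {1..<n}" and w: "?w permutes {1..n}" and IH: "card (inversions n ?w) \<le> length ps"
    using snoc by auto
  have eq: "prod_refl (map (alpha n) (ps @ [p])) = ?w \<circ> Transposition.transpose p (Suc p)"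
    using p by (simp add: prod_refl_append alpha_def refl_perm_def)
  have "?w p \<noteq> ?w (Suc p)"
    using w by (metis n_not_Suc_n permutes_inj inj_eq)
  then have "card (inversions n (?w \<circ> Transposition.transpose p (Suc p))) \<le> Suc (length ps)"
    using card_inversions_adjacent[OF w p] IH by linarith
  moreover have "?w \<circ> Transposition.transpose p (Suc p) permutes {1..n}"
    using p by (intro permutes_compose[OF _ w] permutes_swap_id) auto
  ultimately show ?case unfolding eq length_append_singleton by blast
qed

lemma permutes_no_descent_id:
  assumes w: "w permutes {1..n}" and asc: "\<And>p. p \<in> {1..<n} \<Longrightarrow> w p < w (Suc p)"
  shows "w = id"
proof -
  \<comment> \<open>Strictly increasing integers rise by at least one per step; the bounds
    \<open>w 1 \<ge> 1\<close> and \<open>w n \<le> n\<close> then pin down every value.\<close>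
  have mono: "w a + (b - a) \<le> w b" if "1 \<le> a" "a \<le> b" "b \<le> n" for a b
    using that(2,1,3)
  proof (induction b rule: dec_induct)
    case (step b)
    then show ?case using asc[of b] by auto
  qed simp
  have "w a = a" if "a \<in> {1..n}" for a
  proof -
    have "w 1 \<in> {1..n}" "w n \<in> {1..n}"
      using w that permutes_in_image[OF w, of 1] permutes_in_image[OF w, of n] by auto
    then show ?thesis
      using mono[of 1 a] mono[of a n] that by auto
  qed
  then show ?thesis
    using w by (auto simp: fun_eq_iff permutes_def)
qed

text \<open>Sorting by adjacent swaps: undoing a descent removes exactly one inversion, and without
  descents the permutation is the identity.\<close>

lemma reduced_expression:
  assumes "w permutes {1..n}"
  shows "\<exists>ps. length ps = card (inversions n w) \<and> set ps \<subseteq> {1..<n} \<and>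
    w = prod_refl (map (alpha n) ps)"
  using assms
proof (induction "card (inversions n w)" arbitrary: w rule: less_induct)
  case less
  show ?case
  proof (cases "\<exists>p\<in>{1..<n}. w (Suc p) < w p")
    case True
    then obtain p where p: "p \<in> {1..<n}" "w (Suc p) < w p" by blast
    let ?w = "w \<circ> Transposition.transpose p (Suc p)"
    have w': "?w permutes {1..n}"
      using less.prems p by (intro permutes_compose permutes_swap_id) auto
    have c: "card (inversions n w) = card (inversions n ?w) + 1"
      by (rule card_inversions_adjacent(2)[OF less.prems p])
    then obtain ps where ps: "length ps = card (inversions n ?w)" "set ps \<subseteq> {1..<n}"
      "?w = prod_refl (map (alpha n) ps)"
      using less.hyps[OF _ w'] by auto
    have "w = ?w \<circ> Transposition.transpose p (Suc p)"
      by (auto simp: fun_eq_iff)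
    also have "\<dots> = prod_refl (map (alpha n) (ps @ [p]))"
      using p by (subst ps(3)) (simp add: prod_refl_append alpha_def refl_perm_def)
    finally show ?thesis
      using ps c p by (intro exI[of _ "ps @ [p]"]) auto
  next
    case False
    have "w p < w (Suc p)" if "p \<in> {1..<n}" for p
    proof -
      have "w p \<noteq> w (Suc p)" using less.prems by (metis n_not_Suc_n permutes_inj inj_eq)
      then show ?thesis using False that by force
    qed
    then have "w = id" by (rule permutes_no_descent_id[OF less.prems])
    then show ?thesis
      by (intro exI[of _ "[]"]) (auto simp: inversions_def card_eq_0_iff)
  qed
qed

lemma weyl_length_eq:
  assumes "w permutes {1..n}"
  shows "weyl_length n w = card (inversions n w)"
  unfolding weyl_length_def
  using reduced_expression[OF assms] card_inversions_word_le
  by (intro Least_equality) auto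

section \<open>Edges of the quantum Bruhat graph\<close>

text \<open>Going up, the length change 1 leaves no room for \<open>E\<close>, and the quantum
  change has the wrong sign. Going down, the drop \<open>2 * (b - a) - 1\<close> forces
  \<open>E\<close> to consist of all \<open>b - a - 1\<close> positions between \<open>a\<close> and
  \<open>b\<close>.\<close>

lemma qbg_edge_up_or_down:
  assumes edge: "qbg_edge n w (a, b) v"
  shows "w a < w b \<and> (\<forall>c. a < c \<and> c < b \<longrightarrow> \<not> (w a < w c \<and> w c < w b)) \<or>
    w b < w a \<and> (\<forall>c. a < c \<and> c < b \<longrightarrow> w b < w c \<and> w c < w a)"
proof -
  let ?t = "Transposition.transpose a b"
  have w: "w permutes {1..n}" and ab: "1 \<le> a" "a < b" "b \<le> n" and v: "v = w \<circ> ?t"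
    using edge by (auto simp: qbg_edge_def pos_roots_def refl_perm_def)
  have v_perm: "v permutes {1..n}"
    unfolding v using w ab by (intro permutes_compose permutes_swap_id) auto
  have "2 * coroot_pairing n (rho n) (a, b) = 2 * (real b - real a)"
    using ab by (subst coroot_pairing_eq) (auto simp: rho_eq)
  then have len: "card (inversions n v) = card (inversions n w) + 1 \<or>
      real (card (inversions n v)) = real (card (inversions n w)) - 2 * (real b - real a) + 1"
    using edge by (auto simp: qbg_edge_def weyl_length_eq[OF w] weyl_length_eq[OF v_perm])
  have "w a \<noteq> w b" using w ab by (metis less_irrefl permutes_inj inj_eq)
  then consider "w a < w b" | "w b < w a" by linarith
  then show ?thesis
  proof cases
    case 1
    define E where "E = {c. a < c \<and> c < b \<and> w a < w c \<and> w c < w b}"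
    have fin: "finite E" by (rule finite_subset[of _ "{..b}"]) (auto simp: E_def)
    have "card (inversions n v) = card (inversions n w) + 1 + 2 * card E"
      unfolding v E_def by (rule card_inversions_swap[OF w ab 1])
    then have "card E = 0" using len ab
      by (elim disjE) (simp_all add: of_nat_less_iff[where ?'a = real, symmetric] del: of_nat_less_iff)
    then show ?thesis using 1 fin by (auto simp: E_def)
  next
    case 2
    define E where "E = {c. a < c \<and> c < b \<and> v a < v c \<and> v c < v b}"
    have sub: "E \<subseteq> {a<..<b}" by (auto simp: E_def)
    have "v \<circ> ?t = w" by (auto simp: v fun_eq_iff)
    then have *: "card (inversions n w) = card (inversions n v) + 1 + 2 * card E"
      using card_inversions_swap[OF v_perm ab] 2 by (simp add: v E_def)
    then have "real (card E) = real b - real a - 1" using len by auto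
    then have "card E = card {a<..<b}" using ab by simp
    then have "E = {a<..<b}"
      using sub by (metis card_subset_eq finite_greaterThanLessThan)
    then have "v a < v c \<and> v c < v b" if "a < c" "c < b" for c
      using that by (auto simp: E_def set_eq_iff)
    then have "w b < w c \<and> w c < w a" if "a < c" "c < b" for c
      using that by (fastforce simp: v transpose_def)
    then show ?thesis using 2 by blast
  qed
qed

text \<open>
  Both kinds of edges satisfy one condition that is invariant under cyclic shifts of the values:
  going up cyclically from \<open>w a\<close> to \<open>w b\<close> one meets no \<open>w c\<close> with \<open>c\<close> between \<open>a\<close> and \<open>b\<close>.  So it
  suffices that \<open>y\<close> is the cyclic successor of \<open>x\<close>.
\<close>

lemma qbg_edge_keeps_order:
  assumes edge: "qbg_edge n w (a, b) v"
    and xy: "y = Suc x \<or> x = n \<and> y = 1" "x \<in> {1..n}" "y \<in> {1..n}" "x \<noteq> y"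
    and ne: "\<not> (w a = x \<and> w b = y)" "\<not> (w a = y \<and> w b = x)"
    and ord: "inv w x < inv w y"
  shows "inv v x < inv v y"
proof -
  let ?t = "Transposition.transpose a b"
  have w: "w permutes {1..n}" and ab: "1 \<le> a" "a < b" "b \<le> n" and v: "v = w \<circ> ?t"
    using edge by (auto simp: qbg_edge_def pos_roots_def refl_perm_def)
  have inv_v: "inv v z = ?t (inv w z)" for z
    unfolding v using w by (simp add: o_inv_distrib permutes_bij bij_swap_iff)
  define c d where "c = inv w x" and "d = inv w y"
  have wcd: "w c = x" "w d = y" using w by (auto simp: c_def d_def permutes_inverses)
  have in_n: "w e \<in> {1..n}" if "e \<in> {1..n}" for e
    using w that by (simp only: permutes_in_image)
  have wa: "w a \<in> {1..n}" and wb: "w b \<in> {1..n}" using in_n ab by auto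
  have inj: "w e \<noteq> w f" if "e \<noteq> f" for e f
    using w that by (metis permutes_inj inj_eq)
  have "?t c < ?t d"
  proof (rule ccontr)
    assume "\<not> ?t c < ?t d"
    moreover have "c < d" using ord by (simp add: c_def d_def)
    moreover have "\<not> (c = a \<and> d = b)" using ne wcd by auto
    \<comment> \<open>Apart from the excluded exchange of \<open>x\<close> and \<open>y\<close>,
      swapping the positions \<open>a\<close> and \<open>b\<close> reverses \<open>c < d\<close>
      only if one letter sits at an end and the other strictly inside.\<close>
    ultimately consider "c = a" "a < d" "d < b" | "d = b" "a < c" "c < b"
      using ab by (auto simp: transpose_def split: if_splits)
    then show False
    proof cases
      case 1
      then have "w d \<noteq> w b" using inj by auto
      moreover have "w a < w b \<and> \<not> (w a < w d \<and> w d < w b) \<or> w b < w d \<and> w d < w a"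
        using qbg_edge_up_or_down[OF edge] 1 by blast
      ultimately show False using xy wcd wa wb 1 by auto
    next
      case 2
      then have "w c \<noteq> w a" using inj by auto
      moreover have "w a < w b \<and> \<not> (w a < w c \<and> w c < w b) \<or> w b < w c \<and> w c < w a"
        using qbg_edge_up_or_down[OF edge] 2 by blast
      ultimately show False using xy wcd wa wb 2 by auto
    qed
  qed
  then show ?thesis by (simp add: inv_v c_def d_def)
qed

section \<open>Maxima of piecewise linear functions\<close>

text \<open>\<open>v t\<close> is \<open>f (t / 2)\<close>: the summands with \<open>j < t\<close>
  have reached \<open>s j / 2\<close>, the others still vanish. On each half interval
  \<open>f\<close> is affine, so its supremum is the largest of these values.\<close>

lemma piecewise_linear_SUP:
  fixes s :: "nat \<Rightarrow> real" and c :: real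
  assumes f: "\<And>x. f x = c + (\<Sum>j=0..N. s j * max 0 (min (x - real j / 2) (1 / 2)))"
  defines "v \<equiv> \<lambda>t. c + (\<Sum>j<t. s j) / 2"
  shows "\<And>t. t \<le> Suc N \<Longrightarrow> v t \<le> (SUP x\<in>{0..real N / 2 + 1 / 2}. f x)"
    and "\<exists>t\<le>Suc N. (SUP x\<in>{0..real N / 2 + 1 / 2}. f x) = v t"
proof -
  have part: "f (real t / 2 + u) = v t + s t * u" if "t \<le> N" "0 \<le> u" "u \<le> 1 / 2" for t u
  proof -
    have "(\<Sum>j=0..N. s j * max 0 (min (real t / 2 + u - real j / 2) (1 / 2))) =
        (\<Sum>j=0..N. (if j < t then s j / 2 else 0) + (if j = t then s j * u else 0))"
    proof (intro sum.cong refl)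
      fix j
      consider "j < t" | "j = t" | "t < j" by linarith
      then show "s j * max 0 (min (real t / 2 + u - real j / 2) (1 / 2)) =
          (if j < t then s j / 2 else 0) + (if j = t then s j * u else 0)"
      proof cases
        case 1
        then have "real j + 1 \<le> real t" by linarith
        then have "max 0 (min (real t / 2 + u - real j / 2) (1 / 2)) = 1 / 2"
          using that by linarith
        then show ?thesis using 1 by (simp only:) simp
      next
        case 2
        then show ?thesis using that by simp
      next
        case 3
        then have "real t + 1 \<le> real j" by linarith
        then have "real t / 2 + u - real j / 2 \<le> 0"
          using that by (simp add: field_simps)
        then show ?thesis using 3 by simp
      qed
    qed
    also have "\<dots> = (\<Sum>j=0..N. if j < t then s j / 2 else 0) + s t * u"
      using that by (simp add: sum.distrib)
    also have "(\<Sum>j=0..N. if j < t then s j / 2 else 0) = (\<Sum>j<t. s j / 2)"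
      using that by (intro sum.mono_neutral_cong_right) auto
    finally show ?thesis
      by (simp add: f v_def sum_divide_distrib)
  qed
  have Suc_v: "v (Suc t) = v t + s t / 2" for t
    by (simp add: v_def field_simps)
  have at: "f (real t / 2) = v t" if "t \<le> Suc N" for t
  proof (cases "t \<le> N")
    case True
    then show ?thesis using part[of t 0] by simp
  next
    case False
    then have "t = Suc N" using that by simp
    then show ?thesis using part[of N "1 / 2"] by (simp add: Suc_v field_simps)
  qed
  define z where "z = Max (v ` {..Suc N})"
  have z_ge: "v t \<le> z" if "t \<le> Suc N" for t
    unfolding z_def using that by (intro Max_ge) auto
  have "z \<in> v ` {..Suc N}"
    unfolding z_def by (intro Max_in) auto
  then obtain t0 where t0: "t0 \<le> Suc N" "z = v t0" by blast
  have SUP: "(SUP x\<in>{0..real N / 2 + 1 / 2}. f x) = z"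
  proof (rule cSup_eq_maximum)
    show "z \<in> f ` {0..real N / 2 + 1 / 2}"
      using t0 at[of t0] by (intro image_eqI[of _ _ "real t0 / 2"]) (auto simp: field_simps)
  next
    fix r assume "r \<in> f ` {0..real N / 2 + 1 / 2}"
    then obtain x where x: "0 \<le> x" "x \<le> real N / 2 + 1 / 2" "r = f x" by auto
    define t where "t = nat \<lfloor>2 * x\<rfloor>"
    have t: "real t \<le> 2 * x" "2 * x < real t + 1"
      unfolding t_def using x by (auto simp: of_nat_nat)
    show "r \<le> z"
    proof (cases "t \<le> N")
      case True
      define u where "u = x - real t / 2"
      have u: "0 \<le> u" "u \<le> 1 / 2" using t by (auto simp: u_def field_simps)
      have "r = v t + s t * u" using part[OF True u] x by (simp add: u_def)
      also have "\<dots> \<le> max (v t) (v (Suc t))"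
      proof (cases "0 \<le> s t")
        case True
        then show ?thesis using mult_left_mono[OF u(2) True] by (simp add: Suc_v)
      next
        case False
        then have "s t * u \<le> 0" using u by (intro mult_nonpos_nonneg) auto
        then show ?thesis by simp
      qed
      also have "\<dots> \<le> z" using z_ge[of t] z_ge[of "Suc t"] True by simp
      finally show ?thesis .
    next
      case False
      then have "real t \<ge> real N + 1" by linarith
      then have "x = real (Suc N) / 2" using x t by (simp add: field_simps)
      then have "r = v (Suc N)" using at[OF le_refl] x(3) by (simp only:)
      then show ?thesis using z_ge[of "Suc N"] by simp
    qed
  qed
  show "\<And>t. t \<le> Suc N \<Longrightarrow> v t \<le> (SUP x\<in>{0..real N / 2 + 1 / 2}. f x)"
    unfolding SUP by (rule z_ge)
  show "\<exists>t\<le>Suc N. (SUP x\<in>{0..real N / 2 + 1 / 2}. f x) = v t"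
    unfolding SUP using t0 by blast
qed

section \<open>Heights along a folded path\<close>

text \<open>
  \<open>H j - 1/2\<close> is the height \<open>g\<^sub>\<alpha>\<close> after the first \<open>j\<close> positions of the chain, \<open>neg j\<close> says that
  the path is about to go down, and \<open>U j\<close> is the height at the next half step.
\<close>

locale folded_path =
  fixes m :: nat and H :: "nat \<Rightarrow> int" and neg :: "nat \<Rightarrow> bool" and I J :: "nat set"
  assumes I_sub: "I \<subseteq> {1..m}"
    and fold_H: "j < m \<Longrightarrow> Suc j \<in> I \<Longrightarrow> Suc j \<in> J \<Longrightarrow> H (Suc j) = H j"
    and fold_neg: "j < m \<Longrightarrow> Suc j \<in> I \<Longrightarrow> Suc j \<in> J \<Longrightarrow> neg (Suc j) = (\<not> neg j)"
    and cross_H: "j < m \<Longrightarrow> Suc j \<in> I \<Longrightarrow> Suc j \<notin> J \<Longrightarrow> H (Suc j) = H j + (if neg j then - 1 else 1)"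
    and cross_neg: "j < m \<Longrightarrow> Suc j \<in> I \<Longrightarrow> Suc j \<notin> J \<Longrightarrow> neg (Suc j) = neg j"
    and idle_H: "j < m \<Longrightarrow> Suc j \<notin> I \<Longrightarrow> H (Suc j) = H j"
    and idle_neg: "j < m \<Longrightarrow> Suc j \<notin> I \<Longrightarrow> neg (Suc j) \<Longrightarrow> neg j"
    and start: "H 0 = of_bool (neg 0)"
begin

definition U :: "nat \<Rightarrow> int" where "U j = H j - of_bool (neg j)"

text \<open>Away from \<open>I\<close> the property \<open>neg\<close> can be lost but not gained,
  so it is traced backwards.\<close>

lemma idle_run:
  assumes "j \<le> j'" "j' \<le> m" "\<And>p. p \<in> I \<Longrightarrow> j < p \<Longrightarrow> p \<le> j' \<Longrightarrow> False"
  shows "H j' = H j \<and> (neg j' \<longrightarrow> neg j)"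
  using assms
proof (induction j' rule: dec_induct)
  case (step i)
  have "Suc i \<notin> I" using step.prems(2)[of "Suc i"] step.hyps by auto
  moreover have "H i = H j \<and> (neg i \<longrightarrow> neg j)"
    using step.prems by (intro step.IH) (auto intro: le_SucI)
  ultimately show ?case
    using idle_H[of i] idle_neg[of i] step.prems(1) by auto
qed simp

text \<open>A path about to go up stays so until the next element \<open>e + 1\<close> of
  \<open>I\<close>, or until the end \<open>e = m\<close>. This moves a value of \<open>U\<close> to
  a place where it is compared with the maximum.\<close>

lemma next_event:
  assumes "j \<le> m" "\<not> neg j"
  obtains e where "j \<le> e" "e \<le> m" "e < m \<Longrightarrow> Suc e \<in> I"
    "\<And>p. p \<in> I \<Longrightarrow> j < p \<Longrightarrow> Suc e \<le> p" "U e = U j"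
proof (cases "\<exists>p\<in>I. j < p")
  case True
  define p where "p = (LEAST p. p \<in> I \<and> j < p)"
  have p: "p \<in> I" "j < p" using LeastI_ex[of "\<lambda>p. p \<in> I \<and> j < p"] True by (auto simp: p_def)
  have least: "p \<le> p'" if "p' \<in> I" "j < p'" for p'
    unfolding p_def using that by (intro Least_le) auto
  have "p \<le> m" using p I_sub by auto
  have run: "H (p - 1) = H j \<and> (neg (p - 1) \<longrightarrow> neg j)"
    using p \<open>p \<le> m\<close> least by (intro idle_run) (auto, fastforce)
  show ?thesis
  proof (rule that[of "p - 1"])
    show "Suc (p - 1) \<le> p'" if "p' \<in> I" "j < p'" for p' using least[OF that] p by simp
  qed (use p \<open>p \<le> m\<close> run assms in \<open>auto simp: U_def\<close>)
next
  case False
  have run: "H m = H j \<and> (neg m \<longrightarrow> neg j)"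
    using False assms by (intro idle_run) auto
  show ?thesis
    by (rule that[of m]) (use False run assms in \<open>auto simp: U_def\<close>)
qed

end

text \<open>\<open>M\<close> is the maximum over the breakpoints of \<open>g\<close>: integer
  points, half steps at elements of \<open>I\<close>, and the final half step. It is real because a
  half-integral maximum is not excluded beforehand.\<close>

locale folded_path_max = folded_path +
  fixes M :: real
  assumes M_H: "j \<le> m \<Longrightarrow> H j - 1 / 2 \<le> M"
    and M_event: "j < m \<Longrightarrow> Suc j \<in> I \<Longrightarrow> U j \<le> M"
    and M_end: "U m \<le> M"
    and M_attained: "(\<exists>j\<le>m. M = H j - 1 / 2) \<or> (\<exists>j<m. Suc j \<in> I \<and> M = U j) \<or> M = U m"
begin

lemma U_le_M:
  assumes "j \<le> m"
  shows "U j \<le> M"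
proof (cases "neg j")
  case True
  then show ?thesis using M_H[OF assms] by (simp add: U_def)
next
  case False
  obtain e where "e \<le> m" "e < m \<Longrightarrow> Suc e \<in> I" "U e = U j"
    using next_event[OF assms False] by metis
  then show ?thesis using M_event[of e] M_end by (cases "e < m") auto
qed

text \<open>An integer point of height \<open>M\<close> is left downwards, since otherwise
  \<open>U j\<close> would exceed \<open>M\<close>. Then \<open>neg\<close> goes back to the last
  event before it, whose half step is higher than \<open>M\<close>. With no such event the height is
  the initial one, which is below the threshold.\<close>

lemma M_attained_at_event:
  assumes "of_bool (neg 0) < M"
  shows "\<exists>e\<le>m. (e < m \<longrightarrow> Suc e \<in> I) \<and> M = U e"
proof -
  have False if j: "j \<le> m" "M = H j - 1 / 2" for j
  proof -
    have nj: "neg j"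
      using U_le_M[OF j(1)] j(2) by (cases "neg j") (auto simp: U_def)
    show False
    proof (cases "\<exists>p\<in>I. p \<le> j")
      case True
      define P where "P = {p \<in> I. p \<le> j}"
      have P: "finite P" "P \<noteq> {}" using True by (auto simp: P_def)
      define i where "i = Max P - 1"
      have "Max P \<in> P" using P by (rule Max_in)
      then have i: "Suc i \<in> I" "Suc i \<le> j" "Suc i = Max P" using I_sub by (auto simp: P_def i_def)
      have "H j = H (Suc i) \<and> (neg j \<longrightarrow> neg (Suc i))"
      proof (rule idle_run)
        fix p assume p: "p \<in> I" "Suc i < p" "p \<le> j"
        then have "p \<le> Max P" using P(1) by (intro Max_ge) (simp_all add: P_def)
        then show False using p i(3) by simp
      qed (use i j in auto)
      then have Suc_i: "M = H (Suc i) - 1 / 2" "neg (Suc i)" using j nj by auto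
      have "i < m" using i j by simp
      then have "real_of_int (U i) \<le> M" using M_event i by blast
      moreover have "U i = H (Suc i)"
        using fold_H[OF \<open>i < m\<close> i(1)] fold_neg[OF \<open>i < m\<close> i(1)] cross_H[OF \<open>i < m\<close> i(1)]
          cross_neg[OF \<open>i < m\<close> i(1)] Suc_i(2)
        by (cases "Suc i \<in> J") (auto simp: U_def)
      ultimately show False using Suc_i by simp
    next
      case False
      have "H j = H 0 \<and> (neg j \<longrightarrow> neg 0)"
        using False j by (intro idle_run) auto
      then show False using assms nj j start by simp
    qed
  qed
  then consider e where "e < m" "Suc e \<in> I" "M = U e" | "M = U m"
    using M_attained by auto
  then show ?thesis
    by cases (auto intro: less_imp_le)
qed

text \<open>\<open>e\<close> is the first event, or the end, whose half step reaches
  \<open>M\<close>, and \<open>k\<close> is the last element of \<open>I\<close> up to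
  \<open>e\<close>. The crystal operator will insert \<open>k\<close> and remove
  \<open>e + 1\<close>, or remove nothing if \<open>e = m\<close>.\<close>

lemma folding_segment:
  assumes "of_bool (neg 0) < M"
  obtains k e where "k \<in> I" "k \<le> e" "e \<le> m" "e < m \<Longrightarrow> Suc e \<in> I \<and> Suc e \<in> J" "M = U e"
    "\<And>p. p \<in> I \<Longrightarrow> p \<le> e \<Longrightarrow> p \<le> k \<and> U (p - 1) < M"
    "k \<notin> J" "U (k - 1) = M - 1"
    "\<And>j. k \<le> j \<Longrightarrow> j \<le> e \<Longrightarrow> \<not> neg j \<and> U j = M"
    "\<And>j. j < k \<Longrightarrow> U j < M"
proof -
  define e where "e = (LEAST e. e \<le> m \<and> (e < m \<longrightarrow> Suc e \<in> I) \<and> M = U e)"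
  have e: "e \<le> m" "e < m \<longrightarrow> Suc e \<in> I" "M = U e"
    using LeastI_ex[OF M_attained_at_event[OF assms]] by (auto simp: e_def)
  have least: "e \<le> e'" if "e' \<le> m" "e' < m \<longrightarrow> Suc e' \<in> I" "M = U e'" for e'
    unfolding e_def using that by (intro Least_le) auto
  have before: "U (p - 1) < M" if "p \<in> I" "p \<le> e" for p
  proof -
    have p: "p - 1 < m" "Suc (p - 1) = p" "1 \<le> p" using that e I_sub by auto
    have "U (p - 1) \<le> M" using M_event[OF p(1)] that p by simp
    moreover have "U (p - 1) \<noteq> M" using least[of "p - 1"] that p by auto
    ultimately show ?thesis by simp
  qed
  have ne: "\<not> neg e"
    using M_H[OF e(1)] e(3) by (auto simp: U_def)
  have He: "H e = M" using ne e(3) by (simp add: U_def)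
  define P where "P = {p \<in> I. p \<le> e}"
  have fin: "finite P" by (simp add: P_def)
  \<comment> \<open>Otherwise \<open>M = H e = H 0 = of_bool (neg 0)\<close>, the threshold
    itself.\<close>
  have nonempty: "P \<noteq> {}"
  proof
    assume "P = {}"
    then have "H e = H 0 \<and> (neg e \<longrightarrow> neg 0)" using e by (intro idle_run) (auto simp: P_def)
    then show False using assms start He by simp
  qed
  define k where "k = Max P"
  have "k \<in> P" unfolding k_def using fin nonempty by (rule Max_in)
  then have k: "k \<in> I" "k \<le> e" "1 \<le> k" using I_sub by (auto simp: P_def)
  have k_max: "p \<le> k" if "p \<in> I" "p \<le> e" for p
    unfolding k_def using that fin by (intro Max_ge) (auto simp: P_def)
  have run: "H j = H e" if "k \<le> j" "j \<le> e" for j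
    using idle_run[of j e] that e k_max by fastforce
  have U_run: "\<not> neg j" if "k \<le> j" "j \<le> e" for j
  proof
    assume neg_j: "neg j"
    have "H j = H k \<and> (neg j \<longrightarrow> neg k)"
      using that e k_max by (intro idle_run) (auto dest: k_max)
    then have "neg k" using neg_j by blast
    have km: "k - 1 < m" "Suc (k - 1) = k" using k e by auto
    \<comment> \<open>If the path went down after \<open>k\<close>, the half step at
      \<open>k\<close> would already have the height \<open>H k = M\<close>, against the choice of
      \<open>e\<close>.\<close>
    have "H (k - 1) - of_bool (neg (k - 1)) = H k"
      using fold_H[OF km(1)] fold_neg[OF km(1)] cross_H[OF km(1)] cross_neg[OF km(1)] km(2) \<open>neg k\<close> k
      by (cases "k \<in> J") auto
    then have "U (k - 1) = M" using run[of k] k He by (simp add: U_def)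
    then show False using before k by force
  qed
  have seg: "\<not> neg j \<and> U j = M" if "k \<le> j" "j \<le> e" for j
    using U_run[OF that] run[OF that] He by (simp add: U_def)
  have less: "U j < M" if "j < k" for j
  proof -
    have jm: "j \<le> m" using that k e by simp
    have "U j \<noteq> M"
    proof
      assume UM: "U j = M"
      have nj: "\<not> neg j" using M_H[OF jm] UM by (auto simp: U_def)
      obtain e' where e': "j \<le> e'" "e' \<le> m" "e' < m \<longrightarrow> Suc e' \<in> I"
        "\<And>p. p \<in> I \<Longrightarrow> j < p \<Longrightarrow> Suc e' \<le> p" "U e' = U j"
        using next_event[OF jm nj] by metis
      have "Suc e' \<le> k" using e'(4) k that by blast
      moreover have "e \<le> e'" using least e' UM by simp
      ultimately show False using k by simp
    qed
    then show ?thesis using U_le_M[OF jm] by simp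
  qed
  have km: "k - 1 < m" "Suc (k - 1) = k" using k e by auto
  have nk: "\<not> neg k" "H k = M" using seg[of k] run[of k] He k by auto
  \<comment> \<open>A folding at \<open>k\<close> turns a path going down from
    \<open>H (k - 1) = M\<close> upwards; then the half step of the previous event would already
    have height \<open>M\<close>, or \<open>H 0\<close> would be \<open>M\<close>.\<close>
  have "k \<notin> J"
  proof
    assume "k \<in> J"
    have "neg (k - 1)" "H (k - 1) = M"
      using fold_H[OF km(1)] fold_neg[OF km(1)] km(2) k nk \<open>k \<in> J\<close> by auto
    show False
    proof (cases "\<exists>p\<in>I. p < k")
      case True
      define Q where "Q = {p \<in> I. p < k}"
      have Q: "finite Q" "Q \<noteq> {}" using True by (auto simp: Q_def)
      define i where "i = Max Q - 1"
      have "Max Q \<in> Q" using Q by (rule Max_in)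
      then have i: "Suc i \<in> I" "Suc i \<le> k - 1" "Suc i = Max Q" using I_sub by (auto simp: Q_def i_def)
      have "H (k - 1) = H (Suc i) \<and> (neg (k - 1) \<longrightarrow> neg (Suc i))"
      proof (rule idle_run)
        fix p assume p: "p \<in> I" "Suc i < p" "p \<le> k - 1"
        then have "p \<le> Max Q" using Q(1) km by (intro Max_ge) (simp_all add: Q_def)
        then show False using p i(3) by simp
      qed (use i km in auto)
      then have Suc_i: "H (Suc i) = M" "neg (Suc i)"
        using \<open>neg (k - 1)\<close> \<open>H (k - 1) = M\<close> by auto
      have "i < m" using i km by simp
      have "U i = H (Suc i)"
        using fold_H[OF \<open>i < m\<close> i(1)] fold_neg[OF \<open>i < m\<close> i(1)] cross_H[OF \<open>i < m\<close> i(1)]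
          cross_neg[OF \<open>i < m\<close> i(1)] Suc_i(2)
        by (cases "Suc i \<in> J") (auto simp: U_def)
      then have "U i = M" using Suc_i by simp
      moreover have "i < k" using i by simp
      ultimately show False using less by fastforce
    next
      case False
      have "H (k - 1) = H 0 \<and> (neg (k - 1) \<longrightarrow> neg 0)"
        using False km by (intro idle_run) auto
      then show False using assms start \<open>H (k - 1) = M\<close> \<open>neg (k - 1)\<close> by simp
    qed
  qed
  have "U (k - 1) = M - 1"
    using cross_H[OF km(1)] cross_neg[OF km(1)] km(2) k \<open>k \<notin> J\<close> nk by (auto simp: U_def)
  \<comment> \<open>Crossing upwards at \<open>e + 1\<close> would bring the height to
    \<open>M + 1 / 2\<close>.\<close>
  have inJ: "Suc e \<in> I \<and> Suc e \<in> J" if "e < m"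
  proof (rule ccontr)
    assume "\<not> (Suc e \<in> I \<and> Suc e \<in> J)"
    then have "H (Suc e) = H e + 1" using that e ne cross_H[of e] by auto
    then show False using M_H[of "Suc e"] that He by simp
  qed
  show ?thesis
    by (rule that[of k e])
      (use k e inJ k_max before \<open>k \<notin> J\<close> \<open>U (k - 1) = M - 1\<close> seg less in auto)
qed

end

section \<open>The signature rule\<close>

lemma reduced_word_append: "reduced_word (u @ v) = foldr cancel_cons u (reduced_word v)"
  by (simp add: reduced_word_def)

definition plusses :: "(sign \<times> 'a) list \<Rightarrow> (sign \<times> 'a) list" where
  "plusses w = filter (\<lambda>(s, q). s = Plus) w"

text \<open>A reduced word has all its pluses in front, so a minus put before it cancels the first
  one; if there is none, \<open>tl\<close> of the empty list is empty too.\<close>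

lemma plusses_cancel_Minus:
  assumes "map fst w = replicate x Plus @ replicate y Minus"
  shows "plusses (cancel_cons (Minus, q) w) = tl (plusses w)"
proof (cases w)
  case (Cons p v)
  obtain s r where p: "p = (s, r)" by (cases p)
  show ?thesis
  proof (cases s)
    case Plus
    then show ?thesis by (simp add: Cons p plusses_def)
  next
    case Minus
    then have "x = 0" using assms Cons p by (cases x) auto
    then have "fst a = Minus" if "a \<in> set w" for a
    proof -
      have "fst a \<in> set (map fst w)" using that by simp
      then show ?thesis using assms \<open>x = 0\<close> by (auto split: if_splits)
    qed
    then have "plusses w = []"
      by (fastforce simp: plusses_def filter_empty_conv)
    then show ?thesis using Minus by (simp add: Cons p plusses_def)
  qed
qed (simp add: plusses_def)

text \<open>A column that contains both letters contributes \<open>-+\<close>, which cancels at once.\<close>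

lemma plusses_reduced_word_concat:
  fixes F :: "'a \<Rightarrow> (sign \<times> 'a) list" and c :: "'a \<Rightarrow> int" and qs :: "'a list"
  assumes F: "\<And>q. q \<in> set qs \<Longrightarrow>
      F q = [(Plus, q)] \<and> c q = 1 \<or> F q = [(Minus, q)] \<and> c q = - 1 \<or>
      (F q = [] \<or> F q = [(Minus, q), (Plus, q)]) \<and> c q = 0"
  defines "P \<equiv> plusses (reduced_word (concat (map F qs)))"
  defines "S \<equiv> \<lambda>r. sum_list (map c (take r qs))"
  shows "(\<forall>r\<le>length qs. S r \<le> length P) \<and> (\<exists>r\<le>length qs. S r = length P) \<and>
    (\<forall>r<length qs. S (Suc r) = length P \<longrightarrow> (\<forall>r'\<le>r. S r' < length P) \<longrightarrow>
      P \<noteq> [] \<and> snd (last P) = qs ! r)"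
  using F unfolding P_def S_def
proof (induction qs)
  case Nil
  then show ?case by (simp add: reduced_word_def plusses_def)
next
  \<comment> \<open>A new first column shifts the old partial sums by \<open>c q\<close> and adds
    the empty sum 0, so the maximum becomes the larger of 0 and \<open>c q\<close> plus the old one.
    This matches the effect of \<open>cancel_cons\<close>.\<close>
  case (Cons q qs)
  let ?R = "reduced_word (concat (map F qs))"
  let ?P = "plusses ?R" and ?P' = "plusses (reduced_word (concat (map F (q # qs))))"
  let ?S = "\<lambda>r. sum_list (map c (take r qs))" and ?S' = "\<lambda>r. sum_list (map c (take r (q # qs)))"
  have IH1: "?S r \<le> length ?P" if "r \<le> length qs" for r
    using Cons that by auto
  obtain r0 where r0: "r0 \<le> length qs" "?S r0 = length ?P"
    using Cons by auto
  have IH3: "?P \<noteq> [] \<and> snd (last ?P) = qs ! r"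
    if "r < length qs" "?S (Suc r) = length ?P" "\<forall>r'\<le>r. ?S r' < length ?P" for r
    using Cons that by auto
  obtain x y where xy: "map fst ?R = replicate x Plus @ replicate y Minus"
    using reduced_word_normal by blast
  have S': "?S' 0 = 0" "\<And>r. ?S' (Suc r) = c q + ?S r" by simp_all
  have red: "reduced_word (concat (map F (q # qs))) = foldr cancel_cons (F q) ?R"
    by (simp add: reduced_word_append)
  have cases_r: "r = 0 \<or> (\<exists>s. r = Suc s \<and> s \<le> length qs)" if "r \<le> length (q # qs)" for r
    using that by (cases r) auto
  consider (plus) "F q = [(Plus, q)]" "c q = 1" | (minus) "F q = [(Minus, q)]" "c q = - 1"
    | (zero) "F q = [] \<or> F q = [(Minus, q), (Plus, q)]" "c q = 0"
    using Cons.prems[of q] by auto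
  then show ?case
  proof cases
    case plus
    have P': "?P' = (Plus, q) # ?P" by (simp add: red plus plusses_def del: concat.simps list.map)
    have "?S' r \<le> length ?P'" if "r \<le> length (q # qs)" for r
      using cases_r[OF that] IH1 plus S' unfolding P' by auto
    moreover have "\<exists>r\<le>length (q # qs). ?S' r = length ?P'"
      using r0 plus unfolding P' by (intro exI[of _ "Suc r0"]) auto
    moreover have "?P' \<noteq> [] \<and> snd (last ?P') = (q # qs) ! r"
      if r: "r < length (q # qs)" "?S' (Suc r) = length ?P'" "\<forall>r'\<le>r. ?S' r' < length ?P'" for r
    proof (cases r)
      case 0
      then have "?P = []" using r plus unfolding P' by simp
      then show ?thesis using 0 by (simp add: P' del: concat.simps list.map)
    next
      case (Suc s)
      have "?S r' < length ?P" if "r' \<le> s" for r'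
        using r(3)[rule_format, of "Suc r'"] that Suc plus unfolding P' by simp
      then have "?P \<noteq> [] \<and> snd (last ?P) = qs ! s"
        using r plus Suc unfolding P' by (intro IH3) auto
      then show ?thesis using Suc by (simp add: P' del: concat.simps list.map)
    qed
    ultimately show ?thesis by blast
  next
    case minus
    have P': "?P' = tl ?P"
      using plusses_cancel_Minus[OF xy] by (simp add: red minus del: concat.simps list.map)
    have "?S' r \<le> length ?P'" if "r \<le> length (q # qs)" for r
      using cases_r[OF that]
    proof (elim disjE exE conjE)
      fix s assume "r = Suc s" "s \<le> length qs"
      then show ?thesis using IH1[of s] minus unfolding P' by auto
    qed simp
    moreover have "\<exists>r\<le>length (q # qs). ?S' r = length ?P'"
    proof (cases "?P = []")
      case True
      then show ?thesis unfolding P' by (intro exI[of _ 0]) auto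
    next
      case False
      then have "int (length (tl ?P)) = int (length ?P) - 1"
        by (cases ?P) auto
      then show ?thesis
        using r0 minus unfolding P' by (intro exI[of _ "Suc r0"]) auto
    qed
    moreover have "?P' \<noteq> [] \<and> snd (last ?P') = (q # qs) ! r"
      if r: "r < length (q # qs)" "?S' (Suc r) = length ?P'" "\<forall>r'\<le>r. ?S' r' < length ?P'" for r
    proof (cases r)
      case 0
      then show ?thesis using r minus unfolding P' by simp
    next
      case (Suc s)
      \<comment> \<open>The sum \<open>?S' 0 = 0\<close> lies below the maximum, so a plus survives
        the cancellation of the first one, and the rightmost plus is unchanged.\<close>
      have pos: "0 < length ?P'" using r(3)[rule_format, of 0] by simp
      then have len: "int (length (tl ?P)) = int (length ?P) - 1" "length ?P \<ge> 2"
        unfolding P' by auto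
      have "?S r' < length ?P" if "r' \<le> s" for r'
        using r(3)[rule_format, of "Suc r'"] that Suc minus len unfolding P' by simp
      then have *: "?P \<noteq> [] \<and> snd (last ?P) = qs ! s"
        using r minus Suc len unfolding P' by (intro IH3) auto
      have "tl ?P \<noteq> []" using pos unfolding P' by (rule length_greater_0_conv[THEN iffD1])
      then have "last (tl ?P) = last ?P" by (simp add: last_tl)
      then show ?thesis using * Suc \<open>tl ?P \<noteq> []\<close> unfolding P' by simp
    qed
    ultimately show ?thesis by blast
  next
    case zero
    have P': "?P' = ?P"
      using zero by (auto simp: red simp del: concat.simps list.map)
    have "?S' r \<le> length ?P'" if "r \<le> length (q # qs)" for r
      using cases_r[OF that]
    proof (elim disjE exE conjE)
      fix s assume "r = Suc s" "s \<le> length qs"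
      then show ?thesis using IH1[of s] zero unfolding P' by auto
    qed simp
    moreover have "\<exists>r\<le>length (q # qs). ?S' r = length ?P'"
      using r0 zero unfolding P' by (intro exI[of _ "Suc r0"]) auto
    moreover have "?P' \<noteq> [] \<and> snd (last ?P') = (q # qs) ! r"
      if r: "r < length (q # qs)" "?S' (Suc r) = length ?P'" "\<forall>r'\<le>r. ?S' r' < length ?P'" for r
    proof (cases r)
      case 0
      then show ?thesis using r zero unfolding P' by auto
    next
      case (Suc s)
      have "?S r' < length ?P" if "r' \<le> s" for r'
        using r(3)[rule_format, of "Suc r'"] that Suc zero unfolding P' by simp
      then have "?P \<noteq> [] \<and> snd (last ?P) = qs ! s"
        using r zero Suc unfolding P' by (intro IH3) auto
      then show ?thesis using Suc unfolding P' by simp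
    qed
    ultimately show ?thesis by blast
  qed
qed

section \<open>Foldings of a chain\<close>

lemma sorted_list_of_set_eqI:
  "sorted xs \<Longrightarrow> distinct xs \<Longrightarrow> set xs = A \<Longrightarrow> sorted_list_of_set A = xs"
  for xs :: "'a::linorder list"
  by (metis List.finite_set distinct_sorted_list_of_set set_sorted_list_of_set
      sorted_distinct_set_unique sorted_sorted_list_of_set)

lemma card_less_nth_sorted_list_of_set:
  fixes A :: "'a::linorder set"
  assumes "finite A" "k < card A"
  shows "card {a \<in> A. a < sorted_list_of_set A ! k} = k"
proof -
  let ?xs = "sorted_list_of_set A"
  have len: "length ?xs = card A" by simp
  have mono: "?xs ! i < ?xs ! j" if "i < j" "j < card A" for i j
    using that strict_sorted_list_of_set[of A] sorted_wrt_nth_less[of "(<)" ?xs i j] by simp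
  have nth_in: "?xs ! i \<in> A" if "i < card A" for i
    using that nth_mem[of i ?xs] assms by simp
  have "{a \<in> A. a < ?xs ! k} = (!) ?xs ` {..<k}"
  proof (intro equalityI subsetI)
    fix a assume a: "a \<in> {a \<in> A. a < ?xs ! k}"
    then obtain i where i: "i < card A" "?xs ! i = a"
      using assms set_sorted_list_of_set[of A] unfolding in_set_conv_nth[symmetric] len[symmetric]
      by (metis (no_types, lifting) in_set_conv_nth mem_Collect_eq)
    have "\<not> k < i" using mono[of k i] i a by auto
    moreover have "k \<noteq> i" using i a by auto
    ultimately show "a \<in> (!) ?xs ` {..<k}" using i by auto
  next
    fix a assume "a \<in> (!) ?xs ` {..<k}"
    then show "a \<in> {a \<in> A. a < ?xs ! k}" using assms mono nth_in by auto
  qed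
  moreover have "inj_on ((!) ?xs) {..<k}"
    using assms by (intro inj_on_nth) auto
  ultimately show ?thesis by (simp add: card_image)
qed

lemma nth_sorted_list_of_set_card_less:
  fixes A :: "'a::linorder set"
  assumes "finite A" "e \<in> A"
  shows "sorted_list_of_set A ! card {a \<in> A. a < e} = e"
proof -
  obtain k where "k < card A" "sorted_list_of_set A ! k = e"
    using assms by (metis in_set_conv_nth length_sorted_list_of_set set_sorted_list_of_set)
  then show ?thesis using card_less_nth_sorted_list_of_set[OF assms(1)] by auto
qed

lemma foldr_comp_append:
  "foldr (\<lambda>j f. h j \<circ> f) (xs @ ys) id = foldr (\<lambda>j f. h j \<circ> f) xs id \<circ> foldr (\<lambda>j f. h j \<circ> f) ys id"
proof (induction xs)
  case (Cons x xs)
  then show ?case by (simp only: append_Cons foldr.simps o_apply o_assoc)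
qed simp

locale chain_subset =
  fixes n :: nat and B :: "root list" and J :: "nat set"
  assumes B_pos: "set B \<subseteq> pos_roots n" and J_sub: "J \<subseteq> {1..length B}"
begin

text \<open>\<open>W j\<close> and \<open>A j\<close> describe the path after the first
  \<open>j\<close> positions. Positions count from 1 and lists from 0, so position
  \<open>j + 1\<close> carries the root \<open>B ! j\<close>.\<close>

definition W :: "nat \<Rightarrow> perm" where "W j = refl_upto B {i \<in> J. i \<le> j}"

definition A :: "nat \<Rightarrow> vec \<Rightarrow> vec" where "A j = aff_refl_upto n B {i \<in> J. i \<le> j}"

lemma finite_J: "finite J"
  using J_sub by (rule finite_subset) simp

lemma sorted_list_Suc:
  "sorted_list_of_set {i \<in> J. i \<le> Suc j} =
    sorted_list_of_set {i \<in> J. i \<le> j} @ (if Suc j \<in> J then [Suc j] else [])"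
  using finite_J
  by (intro sorted_list_of_set_eqI) (auto simp: sorted_append le_Suc_eq)

lemma W_0: "W 0 = id"
proof -
  have none: "{i \<in> J. i \<le> 0} = {}" using J_sub by auto
  show ?thesis unfolding W_def refl_upto_def none by simp
qed

lemma A_0: "A 0 = id"
proof -
  have none: "{i \<in> J. i \<le> 0} = {}" using J_sub by auto
  show ?thesis unfolding A_def aff_refl_upto_def none by simp
qed

lemma W_Suc: "W (Suc j) = (if Suc j \<in> J then W j \<circ> refl_perm (B ! j) else W j)"
  by (simp add: W_def refl_upto_def sorted_list_Suc prod_refl_append chain_root_def)

lemma A_Suc: "A (Suc j) =
  (if Suc j \<in> J then A j \<circ> aff_refl n (B ! j) (- int (chain_level B (Suc j))) else A j)"
  unfolding A_def aff_refl_upto_def sorted_list_Suc foldr_comp_append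
  by (simp add: chain_root_def)

lemma W_length: "W (length B) = refl_upto B J"
  and A_length: "A (length B) = aff_refl_upto n B J"
proof -
  have "{i \<in> J. i \<le> length B} = J" using J_sub by auto
  then show "W (length B) = refl_upto B J" "A (length B) = aff_refl_upto n B J"
    by (simp_all add: W_def A_def)
qed

lemma gamma_root_Suc: "gamma_root B J (Suc j) = act_root (W j) (B ! j)"
  by (simp add: gamma_root_def W_def chain_root_def less_Suc_eq_le)

lemma root_at:
  assumes "j < length B"
  obtains a b where "B ! j = (a, b)" "1 \<le> a" "a < b" "b \<le> n" "a \<in> {1..n}" "b \<in> {1..n}"
proof -
  have "B ! j \<in> pos_roots n" using B_pos assms nth_mem by blast
  then show ?thesis using that by (cases "B ! j") (auto simp: pos_roots_def)
qed

lemma W_permutes: "W j permutes {1..n}"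
proof (induction j)
  case 0
  show ?case unfolding W_0 by (rule permutes_id)
next
  case (Suc j)
  show ?case
  proof (cases "Suc j \<in> J")
    case True
    then have "j < length B" using J_sub by auto
    then have "B ! j \<in> pos_roots n" using B_pos nth_mem by blast
    then show ?thesis
      unfolding W_Suc if_P[OF True] by (intro permutes_compose[OF _ Suc.IH] refl_perm_permutes)
  qed (use Suc.IH in \<open>simp add: W_Suc\<close>)
qed

lemma W_inv: "W j (inv (W j) c) = c" "inv (W j) (W j c) = c"
  by (rule permutes_inverses[OF W_permutes])+

lemma W_eq_iff: "W j a = c \<longleftrightarrow> a = inv (W j) c"
  using W_inv by metis

lemma W_in: "W j c \<in> {1..n} \<longleftrightarrow> c \<in> {1..n}"
  by (rule permutes_in_image[OF W_permutes])

lemma inv_W_in: "inv (W j) c \<in> {1..n} \<longleftrightarrow> c \<in> {1..n}"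
  by (rule permutes_in_image[OF permutes_inv[OF W_permutes]])

lemma inv_W_Suc:
  "Suc j \<in> J \<Longrightarrow> inv (W (Suc j)) c = Transposition.transpose (fst (B ! j)) (snd (B ! j)) (inv (W j) c)"
  using permutes_bij[OF W_permutes, of j]
  by (simp add: W_Suc refl_perm_def o_inv_distrib)

text \<open>The linear part of \<open>A j\<close> is \<open>W j\<close>, so \<open>A j\<close> is
  known once the image of a single point is known.\<close>

lemma A_diff: "A j v c - A j z c = v (inv (W j) c) - z (inv (W j) c)"
proof (induction j arbitrary: v z)
  case 0
  then show ?case by (simp add: A_0 W_0)
next
  case (Suc j)
  show ?case
  proof (cases "Suc j \<in> J")
    case True
    then have "j < length B" using J_sub by auto
    then obtain a b where ab: "B ! j = (a, b)" "a < b" "a \<in> {1..n}" "b \<in> {1..n}"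
      by (rule root_at)
    let ?r = "aff_refl n (a, b) (- int (chain_level B (Suc j)))"
    \<comment> \<open>The affine reflection is a transposition of coordinates followed by a
      translation, which cancels in differences.\<close>
    have r: "?r u d = u (Transposition.transpose a b d) - real (chain_level B (Suc j)) * root_vec (a, b) d" for u d
      using ab by (auto simp: aff_refl_def coroot_pairing_eq root_vec_def transpose_def algebra_simps)
    have "A (Suc j) v c - A (Suc j) z c = A j (?r v) c - A j (?r z) c"
      by (simp add: A_Suc True ab)
    also have "\<dots> = ?r v (inv (W j) c) - ?r z (inv (W j) c)" by (rule Suc.IH)
    also have "\<dots> = v (inv (W (Suc j)) c) - z (inv (W (Suc j)) c)"
      by (simp add: r inv_W_Suc[OF True] ab)
    finally show ?thesis .
  qed (simp add: A_Suc W_Suc Suc.IH)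
qed

lemma A_carrier: "v \<in> carrier_vec n \<Longrightarrow> A j v \<in> carrier_vec n"
proof (induction j arbitrary: v)
  case (Suc j)
  show ?case
  proof (cases "Suc j \<in> J")
    case True
    then have "j < length B" using J_sub by auto
    then obtain a b where ab: "B ! j = (a, b)" "a < b" "a \<in> {1..n}" "b \<in> {1..n}"
      by (rule root_at)
    then have "aff_refl n (B ! j) l v \<in> carrier_vec n" for l
      using Suc.prems by (auto simp: carrier_vec_def aff_refl_def root_vec_def)
    then show ?thesis using Suc.IH True by (simp add: A_Suc)
  qed (simp add: A_Suc Suc)
qed (simp add: A_0)

lemma A_onto:
  assumes "z \<in> carrier_vec n"
  shows "\<exists>v\<in>carrier_vec n. A j v = z"
proof
  let ?o = "\<lambda>_. 0 :: real"
  \<comment> \<open>Remove the translation part \<open>A j ?o\<close> from \<open>z\<close>, then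
    undo the permutation of coordinates.\<close>
  let ?v = "\<lambda>c. z (W j c) - A j ?o (W j c)"
  have "A j ?v c = z c" for c
    using A_diff[of j ?v c ?o] by (simp add: W_inv)
  then show "A j ?v = z" by blast
  have "A j ?o \<in> carrier_vec n" by (intro A_carrier) (simp add: carrier_vec_def)
  then show "?v \<in> carrier_vec n"
    using assms permutes_not_in[OF W_permutes[of j]] unfolding carrier_vec_def by simp
qed

text \<open>The image of the hyperplane is again one for the root \<gamma>, and it passes through
  \<open>A j v\<close>; hence one point with integral image fixes its level.\<close>

lemma level_Delta_eq:
  fixes K :: "nat \<Rightarrow> int"
  assumes j: "j < length B"
    and v: "v \<in> hyperplane n (B ! j) (- int (chain_level B (Suc j)))"
    and K: "A j v = (\<lambda>c. - of_int (K c))"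
  shows "level_Delta n B J (Suc j) =
    K (fst (abs_root n (gamma_root B J (Suc j)))) - K (snd (abs_root n (gamma_root B J (Suc j))))"
proof -
  obtain a b where ab: "B ! j = (a, b)" "a < b" "a \<in> {1..n}" "b \<in> {1..n}"
    using j by (rule root_at)
  let ?l = "int (chain_level B (Suc j))"
  let ?H = "hyperplane n (B ! j) (- ?l)"
  obtain c d where cd: "abs_root n (gamma_root B J (Suc j)) = (c, d)" by fastforce
  have "W j a \<noteq> W j b" using W_permutes[of j] ab by (metis less_irrefl permutes_inj inj_eq)
  then have cd': "c \<noteq> d" "c \<in> {1..n}" "d \<in> {1..n}" "(c, d) = (W j a, W j b) \<or> (c, d) = (W j b, W j a)"
    using cd ab W_in[of j a] W_in[of j b]
    by (auto simp: gamma_root_Suc act_root_def abs_root_def neg_root_def split: if_splits)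
  have hyp: "hyperplane n (a', b') l = {z \<in> carrier_vec n. z a' - z b' = of_int l}"
    if "a' \<noteq> b'" "a' \<in> {1..n}" "b' \<in> {1..n}" for a' b' l
    using that by (simp add: hyperplane_def coroot_pairing_eq)
  have H: "?H = {z \<in> carrier_vec n. z a - z b = of_int (- ?l)}"
    using ab by (simp add: hyp)
  have Av: "A j v \<in> carrier_vec n"
    using v by (intro A_carrier) (simp add: hyperplane_def)
  have img: "A j ` ?H = {z \<in> carrier_vec n. z (W j a) - z (W j b) = of_int (K (W j b) - K (W j a))}"
  proof (intro equalityI subsetI)
    fix z assume "z \<in> A j ` ?H"
    then obtain u where u: "u \<in> ?H" "z = A j u" by blast
    have "z \<in> carrier_vec n" using u A_carrier by (simp add: hyperplane_def)
    moreover have "z (W j a) - z (W j b) = of_int (K (W j b) - K (W j a))"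
      using A_diff[of j u "W j a" v] A_diff[of j u "W j b" v] u v unfolding H
      by (simp add: K W_inv)
    ultimately show "z \<in> {z \<in> carrier_vec n. z (W j a) - z (W j b) = of_int (K (W j b) - K (W j a))}"
      by simp
  next
    fix z assume z: "z \<in> {z \<in> carrier_vec n. z (W j a) - z (W j b) = of_int (K (W j b) - K (W j a))}"
    then obtain u where u: "u \<in> carrier_vec n" "A j u = z" using A_onto by blast
    have "u \<in> ?H"
      using A_diff[of j u "W j a" v] A_diff[of j u "W j b" v] u v z unfolding H
      by (simp add: K W_inv)
    then show "z \<in> A j ` ?H" using u by blast
  qed
  have eq: "A j ` ?H = hyperplane n (c, d) (- (K c - K d))"
    using cd' unfolding img by (auto simp: hyp)
  have "level_Delta n B J (Suc j) = (THE l. hyperplane n (c, d) (- l) = A j ` ?H)"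
    by (simp add: level_Delta_def cd A_def chain_root_def less_Suc_eq_le)
  also have "\<dots> = K c - K d"
  proof (rule the_equality)
    show "hyperplane n (c, d) (- (K c - K d)) = A j ` ?H" by (simp add: eq)
  next
    fix l assume "hyperplane n (c, d) (- l) = A j ` ?H"
    then have "A j v \<in> hyperplane n (c, d) (- l)" using v by blast
    then show "l = K c - K d"
      using cd' by (simp add: hyp K flip: of_int_diff of_int_minus)
  qed
  finally show ?thesis by (simp add: cd)
qed

lemma admissible_edge:
  assumes adm: "J \<in> admissible n B" and j: "Suc j \<in> J"
  shows "qbg_edge n (W j) (B ! j) (W (Suc j))"
proof -
  let ?xs = "sorted_list_of_set {i \<in> J. i \<le> j}" and ?ys = "sorted_list_of_set {i \<in> J. Suc j < i}"
  have split: "sorted_list_of_set J = ?xs @ Suc j # ?ys"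
    using finite_J j by (intro sorted_list_of_set_eqI) (auto simp: sorted_append)
  let ?\<beta>s = "map (chain_root B) (sorted_list_of_set J)"
  have \<beta>s: "?\<beta>s = map (chain_root B) ?xs @ B ! j # map (chain_root B) ?ys"
    by (simp add: split chain_root_def)
  have take: "prod_refl (take (length ?xs) ?\<beta>s) = W j"
    "prod_refl (take (Suc (length ?xs)) ?\<beta>s) = W (Suc j)" "?\<beta>s ! length ?xs = B ! j"
    unfolding \<beta>s using j
    by (simp_all add: W_def refl_upto_def sorted_list_Suc nth_append chain_root_def)
  have "length ?xs < length ?\<beta>s" unfolding \<beta>s by simp
  then show ?thesis
    using adm take unfolding admissible_def Let_def by auto
qed

text \<open>Expresses a stretch of the chain by \<open>nths\<close>, the form in which
  \<open>T_seq\<close> selects the foldings of a column.\<close>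

lemma W_add:
  "s + r \<le> length B \<Longrightarrow>
    W (s + r) = W s \<circ> prod_refl (nths (take r (drop s B)) {p. Suc (s + p) \<in> J})"
proof (induction r)
  case (Suc r)
  have "take (Suc r) (drop s B) = take r (drop s B) @ [B ! (s + r)]"
    using Suc.prems by (simp add: take_Suc_conv_app_nth)
  then have "nths (take (Suc r) (drop s B)) {p. Suc (s + p) \<in> J} =
      nths (take r (drop s B)) {p. Suc (s + p) \<in> J} @ (if Suc (s + r) \<in> J then [B ! (s + r)] else [])"
    using Suc.prems by (simp add: nths_append)
  moreover have "W (s + r) = W s \<circ> prod_refl (nths (take r (drop s B)) {p. Suc (s + p) \<in> J})"
    using Suc.prems by (intro Suc.IH) simp
  ultimately show ?case
    by (auto simp: W_Suc prod_refl_append fun_eq_iff)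
qed simp

end

section \<open>The chain \<open>\<Gamma>\<close>\<close>

abbreviation col_before :: "root \<Rightarrow> root \<Rightarrow> bool" where
  "col_before \<equiv> \<lambda>(a, b) (a', b'). a' < a \<or> a = a' \<and> b < b'"

lemma set_Gamma_col: "set (Gamma_col n k) = {(a, b). 1 \<le> a \<and> a \<le> k \<and> k < b \<and> b \<le> n}"
  by (auto simp: Gamma_col_def image_iff simp del: upt_Suc)

lemma sorted_Gamma_col: "sorted_wrt col_before (Gamma_col n k)"
proof -
  have "sorted_wrt col_before (concat (map (\<lambda>a. map (\<lambda>b. (a, b)) [Suc k..<Suc n]) (rev [1..<Suc m])))" for m
  proof (induction m)
    case (Suc m)
    have "sorted_wrt col_before (map (\<lambda>b. (Suc m, b)) [Suc k..<Suc n])"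
      by (simp add: sorted_wrt_map del: upt_Suc)
    moreover have "rev [1..<Suc (Suc m)] = Suc m # rev [1..<Suc m]" by simp
    ultimately show ?case
      using Suc by (auto simp: sorted_wrt_append simp del: upt_Suc)
  qed simp
  then show ?thesis by (simp only: Gamma_col_def)
qed

text \<open>This makes explicit which hyperplanes of a column come before a given position.\<close>

lemma in_take_sorted_wrt:
  assumes sorted: "sorted_wrt R xs" and asym: "\<And>a b. R a b \<Longrightarrow> \<not> R b a" and r: "r < length xs"
  shows "z \<in> set (take r xs) \<longleftrightarrow> z \<in> set xs \<and> R z (xs ! r)"
proof
  assume "z \<in> set (take r xs)"
  then obtain i where "i < r" "z = xs ! i" using r by (auto simp: in_set_conv_nth)
  then show "z \<in> set xs \<and> R z (xs ! r)"
    using sorted_wrt_nth_less[OF sorted] r by auto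
next
  assume z: "z \<in> set xs \<and> R z (xs ! r)"
  then obtain i where i: "i < length xs" "z = xs ! i" by (auto simp: in_set_conv_nth)
  have "i < r"
    using z i sorted_wrt_nth_less[OF sorted, of r i] asym by (metis linorder_neqE_nat)
  then show "z \<in> set (take r xs)" using i r by (auto simp: in_set_conv_nth)
qed

lemma in_take_Gamma_col:
  assumes "r < length (Gamma_col n k)" "Gamma_col n k ! r = (a0, b0)"
  shows "(a, b) \<in> set (take r (Gamma_col n k)) \<longleftrightarrow>
    1 \<le> a \<and> a \<le> k \<and> k < b \<and> b \<le> n \<and> (a0 < a \<or> a = a0 \<and> b < b0)"
proof -
  have "(a, b) \<in> set (take r (Gamma_col n k)) \<longleftrightarrow>
      (a, b) \<in> set (Gamma_col n k) \<and> col_before (a, b) (Gamma_col n k ! r)"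
    by (rule in_take_sorted_wrt[OF sorted_Gamma_col _ assms(1)]) auto
  then show ?thesis by (auto simp: set_Gamma_col assms(2))
qed

lemma distinct_Gamma_col: "distinct (Gamma_col n k)"
proof -
  have "Gamma_col n k ! i \<noteq> Gamma_col n k ! j" if "i < j" "j < length (Gamma_col n k)" for i j
    using sorted_wrt_nth_less[OF sorted_Gamma_col that] by auto
  then show ?thesis
    unfolding distinct_conv_nth by (metis linorder_neqE_nat)
qed

section \<open>Partitions and their conjugates\<close>

lemma partition_below_antimono:
  assumes lam: "partition_below n lam" and i: "1 \<le> i" "i \<le> i'"
  shows "lam i' \<le> lam i"
  using i(2)
proof (induction i' rule: dec_induct)
  case (step j)
  have "lam (Suc j) \<le> lam j" using lam step.hyps i by (auto simp: partition_below_def)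
  then show ?case using step.IH by simp
qed simp

text \<open>As \<open>lam\<close> decreases weakly, the indices counted by \<open>conj_part\<close>
  form an initial segment; it is finite because \<open>q \<ge> 1\<close> and \<open>lam\<close>
  vanishes from \<open>n\<close> on.\<close>

lemma le_conj_part_iff:
  assumes lam: "partition_below n lam" and a: "1 \<le> a" and q: "1 \<le> q"
  shows "a \<le> conj_part lam q \<longleftrightarrow> q \<le> lam a"
proof -
  let ?S = "{i. 1 \<le> i \<and> q \<le> lam i}"
  have fin: "finite ?S"
  proof (rule finite_subset)
    show "?S \<subseteq> {..n}"
    proof
      fix i assume "i \<in> ?S"
      then have "lam i \<noteq> 0" "1 \<le> i" using q by auto
      then show "i \<in> {..n}" using lam by (auto simp: partition_below_def not_le dest: less_imp_le)
    qed
  qed simp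
  note anti = partition_below_antimono[OF lam]
  show ?thesis
  proof
    assume "q \<le> lam a"
    then have "q \<le> lam i" if "i \<in> {1..a}" for i
      using anti[of i a] that by simp
    then have "{1..a} \<subseteq> ?S" by auto
    then have "card {1..a} \<le> card ?S" by (rule card_mono[OF fin])
    then show "a \<le> conj_part lam q" by (simp add: conj_part_def)
  next
    assume le: "a \<le> conj_part lam q"
    show "q \<le> lam a"
    proof (rule ccontr)
      assume "\<not> q \<le> lam a"
      then have "?S \<subseteq> {1..<a}"
        using anti a by (auto simp: not_le) (metis leD le_less_linear order_trans)
      then have "conj_part lam q \<le> a - 1"
        unfolding conj_part_def using card_mono[of "{1..<a}" ?S] by simp
      then show False using le a by simp
    qed
  qed
qed

lemma conj_part_less:
  assumes "partition_below n lam" "1 \<le> q" "1 \<le> n"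
  shows "conj_part lam q < n"
  using le_conj_part_iff[OF assms(1) assms(3,2)] assms by (auto simp: partition_below_def not_le[symmetric])

lemma Gamma_prefix_Suc:
  "Gamma_prefix n lam (Suc q) = Gamma_prefix n lam q @ Gamma_col n (conj_part lam (Suc q))"
  by (simp add: Gamma_prefix_def)

lemma Gamma_prefix_mono:
  "q \<le> q' \<Longrightarrow> \<exists>ys. Gamma_prefix n lam q' = Gamma_prefix n lam q @ ys"
  by (induction q' rule: dec_induct) (auto simp: Gamma_prefix_Suc)

lemma set_Gamma_prefix: "set (Gamma_prefix n lam q) \<subseteq> pos_roots n"
proof (induction q)
  case 0
  show ?case by (simp add: Gamma_prefix_def)
next
  case (Suc q)
  then show ?case by (auto simp: Gamma_prefix_Suc set_Gamma_col pos_roots_def)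
qed

lemma count_list_distinct: "distinct xs \<Longrightarrow> count_list xs a = of_bool (a \<in> set xs)"
  by (induction xs) auto

section \<open>The columns of \<Gamma> and their hyperplanes\<close>

locale gamma_chain =
  fixes n :: nat and lam :: "nat \<Rightarrow> nat" and J :: "nat set"
  assumes n: "2 \<le> n" and lam: "partition_below n lam" and J: "J \<subseteq> {1..length (Gamma n lam)}"

sublocale gamma_chain \<subseteq> chain_subset n "Gamma n lam" J
  using J set_Gamma_prefix by unfold_locales (simp_all add: Gamma_def)

context gamma_chain
begin

abbreviation "B \<equiv> Gamma n lam"
abbreviation "N \<equiv> lam 1"
abbreviation "k \<equiv> conj_part lam"
abbreviation "col q \<equiv> Gamma_col n (k (Suc q))"

text \<open>Column \<open>q + 1\<close> has the roots \<open>col q\<close>, at the positions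
  \<open>P q + 1\<close> to \<open>P (Suc q)\<close>.\<close>

definition P :: "nat \<Rightarrow> nat" where "P q = length (Gamma_prefix n lam q)"

lemma P_0: "P 0 = 0"
  by (simp add: P_def Gamma_prefix_def)

lemma P_Suc: "P (Suc q) = P q + length (col q)"
  by (simp add: P_def Gamma_prefix_Suc)

lemma P_N: "P N = length B"
  by (simp add: P_def Gamma_def)

lemma P_mono: "q \<le> q' \<Longrightarrow> P q \<le> P q'"
  by (rule lift_Suc_mono_le[of P]) (simp_all add: P_Suc)

lemma B_split:
  assumes "q < N"
  obtains ys where "B = Gamma_prefix n lam q @ col q @ ys"
proof -
  have "Suc q \<le> N" using assms by simp
  then show ?thesis
    using that Gamma_prefix_mono[of "Suc q" N n lam] by (auto simp: Gamma_def Gamma_prefix_Suc)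
qed

lemma B_nth:
  assumes "q < N" "r < length (col q)"
  shows "B ! (P q + r) = col q ! r" "P q + r < length B"
proof -
  obtain ys where "B = Gamma_prefix n lam q @ col q @ ys" using B_split[OF assms(1)] .
  then show "B ! (P q + r) = col q ! r" "P q + r < length B"
    using assms by (simp_all add: P_def nth_append)
qed

lemma take_B:
  assumes "q < N" "r \<le> length (col q)"
  shows "take (P q + r) B = Gamma_prefix n lam q @ take r (col q)"
    "take r (drop (P q) B) = take r (col q)"
proof -
  obtain ys where "B = Gamma_prefix n lam q @ col q @ ys" using B_split[OF assms(1)] .
  then show "take (P q + r) B = Gamma_prefix n lam q @ take r (col q)"
    "take r (drop (P q) B) = take r (col q)"
    using assms by (simp_all add: P_def)
qed

lemma position_cases:
  assumes "j < length B"
  obtains q r where "q < N" "r < length (col q)" "j = P q + r"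
proof -
  have "\<exists>q r. q < Q \<and> r < length (col q) \<and> j = P q + r" if "j < P Q" for Q
    using that
  proof (induction Q)
    case 0
    then show ?case by (simp add: P_0)
  next
    case (Suc Q)
    show ?case
    proof (cases "j < P Q")
      case True
      then show ?thesis using Suc.IH by (meson less_SucI)
    next
      case False
      then show ?thesis using Suc.prems
        by (intro exI[of _ Q] exI[of _ "j - P Q"]) (auto simp: P_Suc)
    qed
  qed
  then show ?thesis using that assms P_N by metis
qed

text \<open>An earlier column \<open>c\<close> contains the root \<open>(a, b)\<close> at most once,
  namely if \<open>a \<le> k c < b\<close>, and the current column does not contain it before its
  place \<open>r\<close>.\<close>

lemma chain_level_eq:
  assumes q: "q < N" and r: "r < length (col q)" and ab: "col q ! r = (a, b)"
  shows "chain_level B (Suc (P q + r)) = (\<Sum>c=1..q. of_bool (a \<le> k c \<and> k c < b))"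
proof -
  let ?j = "P q + r"
  have ab': "1 \<le> a" "a < b" "b \<le> n"
    using nth_mem[OF r] ab by (auto simp: set_Gamma_col)
  have "chain_level B (Suc ?j) = card {i. i < ?j \<and> B ! i = (a, b)}"
  proof -
    have "{j. 1 \<le> j \<and> j < Suc ?j \<and> chain_root B j = chain_root B (Suc ?j)} =
        Suc ` {i. i < ?j \<and> B ! i = (a, b)}"
    proof (intro equalityI subsetI)
      fix j assume "j \<in> {j. 1 \<le> j \<and> j < Suc ?j \<and> chain_root B j = chain_root B (Suc ?j)}"
      then show "j \<in> Suc ` {i. i < ?j \<and> B ! i = (a, b)}"
        using B_nth[OF q r] ab by (cases j) (auto simp: chain_root_def)
    qed (use B_nth[OF q r] ab in \<open>auto simp: chain_root_def\<close>)
    then show ?thesis unfolding chain_level_def by (simp add: card_image)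
  qed
  also have "\<dots> = count_list (take ?j B) (a, b)"
  proof -
    have "{i. i < ?j \<and> B ! i = (a, b)} = {i. i < length (take ?j B) \<and> take ?j B ! i = (a, b)}"
      using B_nth(2)[OF q r] by auto
    then show ?thesis
      by (simp add: count_list_eq_length_filter length_filter_conv_card eq_commute)
  qed
  also have "\<dots> = count_list (Gamma_prefix n lam q) (a, b) + count_list (take r (col q)) (a, b)"
    using take_B(1)[OF q] r by simp
  also have "count_list (take r (col q)) (a, b) = 0"
  proof -
    have "(a, b) \<notin> set (take r (col q))"
      using in_take_Gamma_col[OF r ab] by simp
    then show ?thesis by simp
  qed
  also have "count_list (Gamma_prefix n lam q) (a, b) = (\<Sum>c=1..q. of_bool (a \<le> k c \<and> k c < b))" for q
  proof (induction q)
    case 0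
    then show ?case by (simp add: Gamma_prefix_def)
  next
    case (Suc q)
    have "count_list (col q) (a, b) = of_bool (a \<le> k (Suc q) \<and> k (Suc q) < b)"
    proof (cases "(a, b) \<in> set (col q)")
      case True
      then have "count_list (col q) (a, b) = 1"
        using count_list_distinct[OF distinct_Gamma_col] by simp
      then show ?thesis using True by (simp add: set_Gamma_col)
    next
      case False
      then have "\<not> (a \<le> k (Suc q) \<and> k (Suc q) < b)" using ab' by (auto simp: set_Gamma_col)
      then show ?thesis using False by (simp add: count_list_0_iff)
    qed
    then show ?case using Suc by (simp add: Gamma_prefix_Suc)
  qed
  finally show ?thesis by simp
qed

text \<open>
  \<open>Lam q = \<omega>\<^sub>k\<^sub>1 + \<dots> + \<omega>\<^sub>k\<^sub>q\<close>, where \<open>\<omega>\<^sub>k = \<epsilon>\<^sub>1 + \<dots> + \<epsilon>\<^sub>k\<close>, is the weight of the first \<open>q\<close> columns,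
  and \<open>K q\<close> is the content of the first \<open>q\<close> columns of the filling.
\<close>

definition Lam :: "nat \<Rightarrow> nat \<Rightarrow> int" where
  "Lam q a = (\<Sum>c=1..q. of_bool (1 \<le> a \<and> a \<le> k c))"

definition C :: "nat \<Rightarrow> nat set" where "C q = W (P q) ` {1..k q}"

definition K :: "nat \<Rightarrow> nat \<Rightarrow> int" where
  "K q c = (\<Sum>p=1..q. of_bool (c \<in> C p))"

lemma K_Suc: "K (Suc q) c = K q c + of_bool (c \<in> C (Suc q))"
  by (simp add: K_def)

lemma mem_C: "c \<in> C q \<longleftrightarrow> 1 \<le> inv (W (P q)) c \<and> inv (W (P q)) c \<le> k q"
proof
  assume "c \<in> C q"
  then show "1 \<le> inv (W (P q)) c \<and> inv (W (P q)) c \<le> k q"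
    by (auto simp: C_def W_inv)
next
  assume "1 \<le> inv (W (P q)) c \<and> inv (W (P q)) c \<le> k q"
  then show "c \<in> C q"
    unfolding C_def by (intro image_eqI[of _ _ "inv (W (P q)) c"]) (auto simp: W_inv)
qed

lemma k_less: "1 \<le> q \<Longrightarrow> k q < n"
  using conj_part_less[OF lam] n by simp

lemma Lam_carrier: "(\<lambda>a. - real_of_int (Lam q a)) \<in> carrier_vec n"
proof -
  have "Lam q a = 0" if "a \<notin> {1..n}" for a
    unfolding Lam_def using that k_less by (intro sum.neutral) force
  then show ?thesis by (simp add: carrier_vec_def)
qed

text \<open>The level of \<open>(a, b)\<close> counts the earlier columns with
  \<open>a \<le> k c < b\<close>, and so does the difference
  \<open>Lam q a - Lam q b\<close>.\<close>

lemma Lam_hyperplane: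
  assumes q: "q < N" and r: "r < length (col q)"
  shows "(\<lambda>a. - real_of_int (Lam q a)) \<in> hyperplane n (B ! (P q + r)) (- int (chain_level B (Suc (P q + r))))"
proof -
  obtain a b where ab: "col q ! r = (a, b)" by fastforce
  then have ab': "1 \<le> a" "a < b" "b \<le> n" using nth_mem[OF r] by (auto simp: set_Gamma_col)
  have "int (chain_level B (Suc (P q + r))) = Lam q a - Lam q b"
    unfolding chain_level_eq[OF q r ab] Lam_def of_nat_sum sum_subtractf[symmetric]
    using ab' by (intro sum.cong) auto
  then have "of_int (- int (chain_level B (Suc (P q + r)))) = real_of_int (Lam q b - Lam q a)"
    by simp
  then show ?thesis
    using ab' B_nth[OF q r] ab Lam_carrier
    by (simp add: hyperplane_def coroot_pairing_eq)
qed

text \<open>All reflecting hyperplanes of the column \<open>q + 1\<close> contain \<open>- Lam q\<close>.\<close>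

lemma A_Lam_col:
  assumes q: "q < N" and r: "r \<le> length (col q)"
  shows "A (P q + r) (\<lambda>a. - real_of_int (Lam q a)) = A (P q) (\<lambda>a. - real_of_int (Lam q a))"
  using r
proof (induction r)
  case (Suc r)
  let ?v = "\<lambda>a. - real_of_int (Lam q a)"
  have "?v \<in> hyperplane n (B ! (P q + r)) (- int (chain_level B (Suc (P q + r))))"
    using Lam_hyperplane[OF q, of r] Suc.prems by simp
  then have "aff_refl n (B ! (P q + r)) (- int (chain_level B (Suc (P q + r)))) ?v = ?v"
    by (simp add: hyperplane_def aff_refl_def)
  then have "A (Suc (P q + r)) ?v = A (P q + r) ?v"
    by (simp add: A_Suc)
  then show ?case using Suc by simp
qed simp

text \<open>Within a column the image of \<open>- Lam q\<close> is constant. Passing to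
  \<open>- Lam (Suc q)\<close> at its end subtracts the indicator of \<open>{1..k (Suc q)}\<close>,
  which \<open>W (P (Suc q))\<close> turns into that of \<open>C (Suc q)\<close>.\<close>

lemma A_Lam:
  assumes "q \<le> N"
  shows "A (P q) (\<lambda>a. - real_of_int (Lam q a)) = (\<lambda>c. - real_of_int (K q c))"
  using assms
proof (induction q)
  case 0
  show ?case by (simp add: P_0 A_0 Lam_def K_def)
next
  case (Suc q)
  let ?v = "\<lambda>q a. - real_of_int (Lam q a)"
  have q: "q < N" using Suc.prems by simp
  have "A (P (Suc q)) (?v (Suc q)) c = - real_of_int (K (Suc q) c)" for c
  proof -
    let ?c = "inv (W (P (Suc q))) c"
    have "A (P (Suc q)) (?v (Suc q)) c = A (P (Suc q)) (?v q) c + ?v (Suc q) ?c - ?v q ?c"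
      using A_diff[of "P (Suc q)" "?v (Suc q)" c "?v q"] by simp
    also have "A (P (Suc q)) (?v q) c = - real_of_int (K q c)"
      using A_Lam_col[OF q, of "length (col q)"] Suc q by (simp add: P_Suc)
    also have "?v (Suc q) ?c = ?v q ?c - of_bool (c \<in> C (Suc q))"
      by (simp add: mem_C Lam_def)
    finally show ?thesis by (simp add: K_Suc)
  qed
  then show ?case by blast
qed

lemma level_Delta_col:
  assumes q: "q < N" and r: "r < length (col q)"
  shows "level_Delta n B J (Suc (P q + r)) =
    K q (fst (abs_root n (gamma_root B J (Suc (P q + r))))) -
    K q (snd (abs_root n (gamma_root B J (Suc (P q + r)))))"
  using A_Lam_col[OF q, of r] A_Lam[of q] q r
  by (intro level_Delta_eq[OF B_nth(2)[OF q r] Lam_hyperplane[OF q r]]) simp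

lemma weight_vec_eq: "weight_vec n lam = (\<lambda>a. real_of_int (Lam N a))"
proof
  fix a
  show "weight_vec n lam a = real_of_int (Lam N a)"
  proof (cases "a \<in> {1..n}")
    case False
    then show ?thesis using Lam_carrier[of N] by (auto simp: weight_vec_def carrier_vec_def)
  next
    case True
    have le: "lam a \<le> N" using partition_below_antimono[OF lam, of 1 a] True by simp
    have "Lam N a = (\<Sum>c=1..N. of_bool (c \<le> lam a))"
      unfolding Lam_def using True le_conj_part_iff[OF lam] by (intro sum.cong) auto
    also have "\<dots> = int (card {c \<in> {1..N}. c \<le> lam a})"
      by (simp add: sum.If_cases of_bool_def Int_def)
    also have "{c \<in> {1..N}. c \<le> lam a} = {1..lam a}" using le by auto
    finally show ?thesis using True by (simp add: weight_vec_def)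
  qed
qed

text \<open>The weight of \<open>J\<close> is the content of its filling; this provides the level at
  \<infinity>.\<close>

lemma mu_eq: "mu n B (weight_vec n lam) J = (\<lambda>c. real_of_int (K N c))"
  using A_Lam[OF le_refl] unfolding P_N A_length by (simp add: mu_def weight_vec_eq)

section \<open>The filling in terms of the partial products\<close>

lemma fill_perm_eq:
  "q \<le> N \<Longrightarrow> fill_perm n lam J q = W (P q)"
proof (induction q)
  case 0
  then show ?case by (simp add: fill_perm_def P_0 W_0)
next
  case (Suc q)
  have q: "q < N" using Suc.prems by simp
  have "P (Suc q) \<le> length B" using P_mono[OF Suc.prems] unfolding P_N .
  then have "W (P (Suc q)) = W (P q) \<circ> prod_refl (nths (col q) {p. Suc (P q + p) \<in> J})"
    using W_add[of "P q" "length (col q)"] take_B(2)[OF q, of "length (col q)"] by (simp add: P_Suc)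
  also have "nths (col q) {p. Suc (P q + p) \<in> J} = T_seq n lam J (Suc q)"
    by (simp add: T_seq_def P_def)
  also have "W (P q) \<circ> prod_refl (T_seq n lam J (Suc q)) = fill_perm n lam J (Suc q)"
    using Suc q by (simp add: fill_perm_def prod_refl_append)
  finally show ?case ..
qed

lemma sfill_nth:
  assumes "q < N"
  shows "sfill n lam J ! q = sorted_list_of_set (C (Suc q))"
proof -
  let ?xs = "map (W (P (Suc q))) [1..<Suc (k (Suc q))]"
  have "sfill n lam J ! q = sort ?xs"
    using assms fill_perm_eq[of "Suc q"] by (simp add: sfill_def fill_def del: upt_Suc)
  also have "\<dots> = sorted_list_of_set (C (Suc q))"
  proof (rule sorted_list_of_set_eqI[symmetric])
    show "distinct (sort ?xs)"
      using permutes_inj_on[OF W_permutes] by (simp add: distinct_map del: upt_Suc)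
    show "set (sort ?xs) = C (Suc q)"
      by (simp add: C_def atLeastLessThanSuc_atLeastAtMost del: upt_Suc)
  qed simp
  finally show ?thesis .
qed

lemma length_sfill: "length (sfill n lam J) = N"
  by (simp add: sfill_def fill_def)

lemma finite_C: "finite (C q)"
  by (simp add: C_def)

lemma C_sub: "1 \<le> q \<Longrightarrow> C q \<subseteq> {1..n}"
  unfolding C_def using W_in k_less[of q] by (auto simp del: atLeastAtMost_iff) auto

lemma card_C: "card (C q) = k q"
  unfolding C_def using permutes_inj_on[OF W_permutes] by (simp add: card_image)

lemma sfill_KR: "sfill n lam J \<in> KR_crystal n lam"
  using C_sub by (auto simp: KR_crystal_def length_sfill sfill_nth card_C finite_C)

end

section \<open>Heights along the chain\<close>

locale alcove_path = gamma_chain +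
  fixes i :: nat
  assumes i: "i \<le> n - 1" and adm: "J \<in> admissible n (Gamma n lam)"
begin

abbreviation "x \<equiv> plus_letter n i"
abbreviation "y \<equiv> minus_letter i"

lemma alpha_eq: "alpha n i = (x, y)"
  by (simp add: alpha_def plus_letter_def minus_letter_def)

lemma xy: "x \<noteq> y" "x \<in> {1..n}" "y \<in> {1..n}" "y = Suc x \<or> x = n \<and> y = 1"
  using i n by (auto simp: plus_letter_def minus_letter_def)

lemma alpha_pos_iff: "(x, y) \<in> pos_roots n \<longleftrightarrow> i \<noteq> 0"
  using i n by (auto simp: plus_letter_def minus_letter_def pos_roots_def)

lemma neg_alpha_pos_iff: "(y, x) \<in> pos_roots n \<longleftrightarrow> i = 0"
  using i n by (auto simp: plus_letter_def minus_letter_def pos_roots_def)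

definition I :: "nat set" where "I = I_set B J (x, y)"

text \<open>Equivalently, \<open>inv (W j)\<close> sends the root \<open>(x, y)\<close> to a
  negative one: in the one-line notation of \<open>W j\<close> the letter \<open>y\<close> precedes
  \<open>x\<close>.\<close>

definition neg :: "nat \<Rightarrow> bool" where "neg j \<longleftrightarrow> inv (W j) y < inv (W j) x"

text \<open>A folding goes half a step forth and back, so only crossings change the height at
  integer points. The initial term accounts for \<open>i = 0\<close>, where the root is negative and
  \<open>g\<close> starts at \<open>1 / 2\<close>.\<close>

definition H :: "nat \<Rightarrow> int" where
  "H j = of_bool (neg 0) +
    (\<Sum>e=1..j. if e \<in> I \<and> e \<notin> J then (if gamma_root B J e = (x, y) then 1 else - 1) else 0)"

lemma neg_0: "neg 0 \<longleftrightarrow> i = 0"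
  using neg_alpha_pos_iff xy by (auto simp: neg_def W_0 pos_roots_def)

lemma inv_W_neq: "inv (W j) x \<noteq> inv (W j) y"
  using xy(1) W_inv by metis

lemma I_subset: "I \<subseteq> {1..length B}"
  by (auto simp: I_def I_set_def)

text \<open>Chain roots are positive, so the order of the positions of \<open>x\<close> and
  \<open>y\<close> decides which of the two roots is met.\<close>

lemma event_cases:
  assumes "j < length B" "Suc j \<in> I"
  shows "\<not> neg j \<and> gamma_root B J (Suc j) = (x, y) \<and> B ! j = (inv (W j) x, inv (W j) y) \<or>
    neg j \<and> gamma_root B J (Suc j) = (y, x) \<and> B ! j = (inv (W j) y, inv (W j) x)"
proof -
  obtain a b where ab: "B ! j = (a, b)" "a < b" using assms(1) by (rule root_at)
  have g: "gamma_root B J (Suc j) = (W j a, W j b)" by (simp add: gamma_root_Suc act_root_def ab)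
  have "(W j a, W j b) = (x, y) \<or> (W j a, W j b) = (y, x)"
    using assms(2) g by (auto simp: I_def I_set_def neg_root_def)
  then show ?thesis
    using ab g by (auto simp: W_eq_iff neg_def)
qed

lemma event_iff:
  assumes "j < length B"
  shows "Suc j \<in> I \<longleftrightarrow> B ! j = (inv (W j) x, inv (W j) y) \<or> B ! j = (inv (W j) y, inv (W j) x)"
proof
  assume "Suc j \<in> I"
  then show "B ! j = (inv (W j) x, inv (W j) y) \<or> B ! j = (inv (W j) y, inv (W j) x)"
    using event_cases[OF assms] by blast
next
  assume "B ! j = (inv (W j) x, inv (W j) y) \<or> B ! j = (inv (W j) y, inv (W j) x)"
  then show "Suc j \<in> I"
    using assms by (auto simp: I_def I_set_def gamma_root_Suc act_root_def W_inv neg_root_def)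
qed

lemma H_Suc:
  "H (Suc j) = H j + (if Suc j \<in> I \<and> Suc j \<notin> J
    then (if gamma_root B J (Suc j) = (x, y) then 1 else - 1) else 0)"
  by (simp add: H_def)

end

sublocale alcove_path \<subseteq> folded_path "length B" H neg I J
proof
  show "I \<subseteq> {1..length B}" by (rule I_subset)
next
  fix j assume j: "j < length B" "Suc j \<in> I" "Suc j \<in> J"
  show "H (Suc j) = H j" using j by (simp add: H_Suc)
  show "neg (Suc j) = (\<not> neg j)"
    using event_cases[OF j(1,2)] inv_W_neq[of j] by (auto simp: neg_def inv_W_Suc[OF j(3)])
next
  fix j assume j: "j < length B" "Suc j \<in> I" "Suc j \<notin> J"
  show "H (Suc j) = H j + (if neg j then - 1 else 1)"
    using event_cases[OF j(1,2)] j xy(1) by (auto simp: H_Suc)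
  show "neg (Suc j) = neg j" using j by (simp add: neg_def W_Suc)
next
  fix j assume j: "j < length B" "Suc j \<notin> I"
  show "H (Suc j) = H j" using j by (simp add: H_Suc)
  assume neg': "neg (Suc j)"
  show "neg j"
  proof (cases "Suc j \<in> J")
    case False
    then show ?thesis using neg' by (simp add: neg_def W_Suc)
  next
    case True
    obtain a b where ab: "B ! j = (a, b)" using j(1) by (rule root_at)
    \<comment> \<open>This folding is an edge that does not exchange \<open>x\<close> and
      \<open>y\<close>, and such an edge cannot move \<open>y\<close> ahead of
      \<open>x\<close>.\<close>
    have edge: "qbg_edge n (W j) (a, b) (W (Suc j))"
      using admissible_edge[OF adm True] ab by simp
    have ne: "\<not> (W j a = x \<and> W j b = y)" "\<not> (W j a = y \<and> W j b = x)"
      using j event_iff[OF j(1)] ab by (auto simp: W_eq_iff)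
    show ?thesis
    proof (rule ccontr)
      assume "\<not> neg j"
      then have "inv (W j) x < inv (W j) y" using inv_W_neq[of j] by (simp add: neg_def)
      then have "inv (W (Suc j)) x < inv (W (Suc j)) y"
        using qbg_edge_keeps_order[OF edge xy(4,2,3,1) ne] by simp
      then show False using neg' by (simp add: neg_def)
    qed
  qed
next
  show "H 0 = of_bool (neg 0)" by (simp add: H_def)
qed

context alcove_path
begin

definition h :: "nat \<Rightarrow> int" where "h q = K q x - K q y"

text \<open>
  Within a column, \<open>H\<close> is a function of the position reached in the column and of the positions of
  \<open>x\<close> and \<open>y\<close> in the current permutation.  It is the level of the current alcove: \<open>passed q r\<close>
  records which hyperplanes have been crossed.  Folding does not change this level, since the roots
  of a column are in a reflection order.
\<close>

definition passed :: "nat \<Rightarrow> nat \<Rightarrow> nat \<Rightarrow> nat \<Rightarrow> int" where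
  "passed q r a b = (if a < b then of_bool ((a, b) \<in> set (take r (col q)))
    else 1 - of_bool ((b, a) \<in> set (take r (col q))))"

lemma in_take_Suc:
  assumes "r < length (col q)" "col q ! r = (a0, b0)"
  shows "(a, b) \<in> set (take r (col q)) \<longleftrightarrow>
      1 \<le> a \<and> a \<le> k (Suc q) \<and> k (Suc q) < b \<and> b \<le> n \<and> (a0 < a \<or> a = a0 \<and> b < b0)"
    and "(a, b) \<in> set (take (Suc r) (col q)) \<longleftrightarrow>
      1 \<le> a \<and> a \<le> k (Suc q) \<and> k (Suc q) < b \<and> b \<le> n \<and> (a0 < a \<or> a = a0 \<and> b \<le> b0)"
proof -
  have "1 \<le> a0 \<and> a0 \<le> k (Suc q) \<and> k (Suc q) < b0 \<and> b0 \<le> n"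
    using nth_mem[OF assms(1)] by (simp add: assms(2) set_Gamma_col)
  then show "(a, b) \<in> set (take r (col q)) \<longleftrightarrow>
      1 \<le> a \<and> a \<le> k (Suc q) \<and> k (Suc q) < b \<and> b \<le> n \<and> (a0 < a \<or> a = a0 \<and> b < b0)"
    "(a, b) \<in> set (take (Suc r) (col q)) \<longleftrightarrow>
      1 \<le> a \<and> a \<le> k (Suc q) \<and> k (Suc q) < b \<and> b \<le> n \<and> (a0 < a \<or> a = a0 \<and> b \<le> b0)"
    using assms by (auto simp: take_Suc_conv_app_nth in_take_Gamma_col)
qed

text \<open>For \<open>c > k (Suc q)\<close> other than \<open>b0\<close>, the root
  \<open>(a0, c)\<close> has been passed exactly if \<open>c < b0\<close>, and this is the constant
  value of \<open>passed\<close> at \<open>(b0, c)\<close>. For \<open>c \<le> k (Suc q)\<close>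
  other than \<open>a0\<close>, likewise \<open>(c, b0)\<close> has been passed exactly if
  \<open>a0 < c\<close>, the constant value at \<open>(c, a0)\<close>.\<close>

lemma passed_Suc_fold:
  assumes r: "r < length (col q)" and c0: "col q ! r = (a0, b0)"
    and ab: "a \<noteq> b" "a \<in> {1..n}" "b \<in> {1..n}"
  shows "passed q (Suc r) (Transposition.transpose a0 b0 a) (Transposition.transpose a0 b0 b) =
    passed q r a b"
proof -
  have *: "1 \<le> a0" "a0 \<le> k (Suc q)" "k (Suc q) < b0" "b0 \<le> n"
    using nth_mem[OF r] by (simp_all add: c0 set_Gamma_col)
  have ab': "1 \<le> a" "1 \<le> b" "a \<le> n" "b \<le> n" using ab by auto
  consider "a = a0" | "a = b0" | "a \<noteq> a0" "a \<noteq> b0" by blast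
  then show ?thesis
  proof cases
    case 1
    then show ?thesis using * ab(1) ab' in_take_Suc[OF r c0]
      by (cases "b = b0") (auto simp: passed_def transpose_def)
  next
    case 2
    then show ?thesis using * ab(1) ab' in_take_Suc[OF r c0]
      by (cases "b = a0") (auto simp: passed_def transpose_def)
  next
    case 3
    then show ?thesis using * ab(1) ab' in_take_Suc[OF r c0]
      by (cases "b = a0"; cases "b = b0") (auto simp: passed_def transpose_def)
  qed
qed

lemma passed_Suc:
  assumes r: "r < length (col q)" and c0: "col q ! r = (a0, b0)" and ab: "a \<noteq> b"
  shows "passed q (Suc r) a b =
    passed q r a b + (if (a, b) = (a0, b0) then 1 else if (b, a) = (a0, b0) then - 1 else 0)"
proof -
  have *: "1 \<le> a0" "a0 \<le> k (Suc q)" "k (Suc q) < b0" "b0 \<le> n"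
    using nth_mem[OF r] by (simp_all add: c0 set_Gamma_col)
  moreover have "set (take (Suc r) (col q)) = insert (a0, b0) (set (take r (col q)))"
    using r by (simp add: take_Suc_conv_app_nth c0)
  moreover have "(a0, b0) \<notin> set (take r (col q))" by (simp add: in_take_Gamma_col[OF r c0])
  ultimately show ?thesis using ab by (auto simp: passed_def)
qed

lemma H_in_col:
  assumes q: "q < N" and start: "H (P q) = h q + of_bool (neg (P q))" and r: "r \<le> length (col q)"
  shows "H (P q + r) = h q + passed q r (inv (W (P q + r)) x) (inv (W (P q + r)) y)"
  using r
proof (induction r)
  case 0
  show ?case using start inv_W_neq[of "P q"] by (auto simp: passed_def neg_def)
next
  case (Suc r)
  let ?j = "P q + r"
  let ?a = "inv (W ?j) x" and ?b = "inv (W ?j) y"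
  have r: "r < length (col q)" using Suc.prems by simp
  have j: "?j < length B" "B ! ?j = col q ! r" using B_nth[OF q r] by auto
  obtain a0 b0 where c0: "col q ! r = (a0, b0)" by fastforce
  have IH: "H ?j = h q + passed q r ?a ?b" using Suc r by simp
  have ne: "?a \<noteq> ?b" by (rule inv_W_neq)
  show ?case
  proof (cases "Suc ?j \<in> J")
    case True
    have "H (Suc ?j) = H ?j" using True by (simp add: H_Suc)
    moreover have "?a \<in> {1..n}" "?b \<in> {1..n}" using xy inv_W_in by blast+
    ultimately show ?thesis
      using IH passed_Suc_fold[OF r c0 ne] by (simp add: inv_W_Suc[OF True] j c0)
  next
    case False
    have W: "W (Suc ?j) = W ?j" using False by (simp add: W_Suc)
    have "a0 < b0" using nth_mem[OF r] by (simp add: c0 set_Gamma_col)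
    have "H (Suc ?j) = H ?j + (if (?a, ?b) = (a0, b0) then 1 else if (?b, ?a) = (a0, b0) then - 1 else 0)"
    proof (cases "Suc ?j \<in> I")
      case True
      then show ?thesis
        using event_cases[OF j(1) True] False cross_H[OF j(1) True] ne \<open>a0 < b0\<close> by (auto simp: j c0)
    next
      case not_event: False
      then show ?thesis
        using event_iff[OF j(1)] idle_H[OF j(1)] by (auto simp: j c0)
    qed
    then show ?thesis
      using IH passed_Suc[OF r c0 ne] by (simp add: W)
  qed
qed

lemma H_P: "q \<le> N \<Longrightarrow> H (P q) = h q + of_bool (neg (P q))"
proof (induction q)
  case 0
  show ?case by (simp add: P_0 H_def h_def K_def)
next
  case (Suc q)
  have q: "q < N" using Suc.prems by simp
  let ?a = "inv (W (P (Suc q))) x" and ?b = "inv (W (P (Suc q))) y"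
  have "H (P (Suc q)) = h q + passed q (length (col q)) ?a ?b"
    using H_in_col[OF q _ le_refl] Suc by (simp add: P_Suc)
  \<comment> \<open>At the end of the column all its roots are passed, so \<open>passed\<close> is
    the contribution of the column to \<open>h\<close> plus the initial value 1 if
    \<open>neg\<close> holds.\<close>
  also have "\<dots> = h (Suc q) + of_bool (neg (P (Suc q)))"
  proof -
    have in_n: "?a \<in> {1..n}" "?b \<in> {1..n}" using xy inv_W_in by blast+
    have ne: "?a \<noteq> ?b" by (rule inv_W_neq)
    show ?thesis
      using in_n ne by (auto simp: h_def K_Suc mem_C passed_def set_Gamma_col neg_def)
  qed
  finally show ?case .
qed

lemma U_P: "q \<le> N \<Longrightarrow> U (P q) = h q"
  by (simp add: U_def H_P)

text \<open>The hyperplane of an event is not passed before its own position, so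
  \<open>passed\<close> is 1 or 0 there according to \<open>neg\<close>, and \<open>U\<close>
  subtracts this again.\<close>

lemma U_event:
  assumes q: "q < N" and r: "r < length (col q)" and I: "Suc (P q + r) \<in> I"
  shows "U (P q + r) = h q"
proof -
  let ?j = "P q + r"
  have j: "?j < length B" "B ! ?j = col q ! r" using B_nth[OF q r] by auto
  obtain a0 b0 where c0: "col q ! r = (a0, b0)" by fastforce
  have "a0 < b0" using nth_mem[OF r] by (simp add: c0 set_Gamma_col)
  have "H ?j = h q + passed q r (inv (W ?j) x) (inv (W ?j) y)"
    using H_in_col[OF q] H_P q r by simp
  then show ?thesis
    using event_cases[OF j(1) I] \<open>a0 < b0\<close> in_take_Suc(1)[OF r c0]
    by (auto simp: U_def passed_def j c0)
qed

text \<open>For \<open>i = 0\<close> both the sign and the order of the letters in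
  \<open>abs_root\<close> flip, so the left side is \<open>h q\<close> for the column of
  \<open>p\<close> in either case.\<close>

lemma level_Delta_event:
  assumes I: "p \<in> I"
  shows "sgn_root n (x, y) * level_Delta n B J p = U (p - 1)"
proof -
  have "p \<in> {1..length B}" using I I_subset by blast
  then have p: "p - 1 < length B" "p = Suc (p - 1)" by auto
  obtain q r where qr: "q < N" "r < length (col q)" "p - 1 = P q + r"
    using p(1) by (rule position_cases)
  have p': "p = Suc (P q + r)" using p qr by simp
  have "gamma_root B J p = (x, y) \<or> gamma_root B J p = (y, x)"
    using I by (auto simp: I_def I_set_def neg_root_def)
  then have "sgn_root n (x, y) * level_Delta n B J p = h q"
    using level_Delta_col[OF qr(1,2)] alpha_pos_iff neg_alpha_pos_iff unfolding p'
    by (auto simp: sgn_root_def abs_root_def neg_root_def h_def)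
  then show ?thesis using U_event[OF qr(1,2)] I p' by simp
qed

lemma level_Delta_end:
  "of_int (sgn_root n (x, y)) * level_Delta_hat n B (weight_vec n lam) J (x, y) \<infinity> =
    real_of_int (U (length B))"
  using U_P[OF le_refl] xy unfolding P_N
  by (simp add: level_Delta_hat_def mu_eq coroot_pairing_eq h_def sgn_root_def)

section \<open>The maximum of \<open>g\<^sub>\<alpha>\<close>\<close>

definition slope :: "nat \<Rightarrow> real" where
  "slope t = (if i = 0 then - g_slope n B J (y, x) t else g_slope n B J (x, y) t)"

text \<open>The value of \<open>g\<close> at \<open>t / 2\<close>.\<close>

definition g_half :: "nat \<Rightarrow> real" where
  "g_half t = of_bool (i = 0) - 1 / 2 + (\<Sum>s<t. slope s) / 2"

abbreviation "M \<equiv> g_max n B J (x, y)"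

lemma I_set_neg: "I_set B J (y, x) = I"
  by (auto simp: I_def I_set_def neg_root_def)

lemma finite_I: "finite I"
  using I_subset by (rule finite_subset) simp

lemma g_fun_eq:
  "g_fun n B J (x, y) z = (of_bool (i = 0) - 1 / 2) +
    (\<Sum>s=0..2 * card I. slope s * max 0 (min (z - real s / 2) (1 / 2)))"
  unfolding g_fun_def g_pos_def neg_root_def fst_conv snd_conv I_set_neg I_def[symmetric] slope_def
    alpha_pos_iff
  by (simp add: sum_negf)

lemma g_max_bounds:
  shows "\<And>t. t \<le> Suc (2 * card I) \<Longrightarrow> g_half t \<le> M"
    and "\<exists>t\<le>Suc (2 * card I). M = g_half t"
proof -
  have M: "M = (SUP z\<in>{0..real (2 * card I) / 2 + 1 / 2}. g_fun n B J (x, y) z)"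
    by (simp add: g_max_def I_def)
  show "\<And>t. t \<le> Suc (2 * card I) \<Longrightarrow> g_half t \<le> M"
    unfolding M g_half_def by (rule piecewise_linear_SUP(1)[OF g_fun_eq])
  show "\<exists>t\<le>Suc (2 * card I). M = g_half t"
    unfolding M g_half_def by (rule piecewise_linear_SUP(2)[OF g_fun_eq])
qed

definition sign_at :: "nat \<Rightarrow> real" where "sign_at j = (if neg j then - 1 else 1)"

text \<open>With \<open>t\<close> events before it, this event occupies the interval from
  \<open>t\<close> to \<open>t + 1\<close> of \<open>g\<close>. For \<open>i = 0\<close> the two
  sign changes, of the root and of \<open>g\<close>, cancel.\<close>

lemma slope_event:
  assumes j: "j < length B" "Suc j \<in> I"
  defines "t \<equiv> card {e \<in> I. e \<le> j}"
  shows "slope (2 * t) = sign_at j" "slope (2 * t + 1) = (if Suc j \<in> J then - 1 else 1) * sign_at j"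
    and "t < card I"
proof -
  have t: "t = card {e \<in> I. e < Suc j}" by (simp add: t_def less_Suc_eq_le)
  have nth: "sorted_list_of_set I ! t = Suc j"
    unfolding t by (rule nth_sorted_list_of_set_card_less[OF finite_I j(2)])
  show "t < card I"
    unfolding t using j finite_I by (intro psubset_card_mono) auto
  then have ne: "2 * t \<noteq> 2 * card I" "2 * t + 1 \<noteq> 2 * card I" by presburger+
  have div2: "2 * t div 2 = t" "(2 * t + 1) div 2 = t" by simp_all
  have sign: "(if i = 0 then - real_of_int (sgn_root n (gamma_root B J (Suc j)))
      else real_of_int (sgn_root n (gamma_root B J (Suc j)))) = sign_at j"
  proof (cases "neg j")
    case True
    then have g: "gamma_root B J (Suc j) = (y, x)" using event_cases[OF j] by blast
    show ?thesis unfolding g sgn_root_def neg_alpha_pos_iff sign_at_def using True by simp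
  next
    case False
    then have g: "gamma_root B J (Suc j) = (x, y)" using event_cases[OF j] by blast
    show ?thesis unfolding g sgn_root_def alpha_pos_iff sign_at_def using False by simp
  qed
  have ev: "even (2 * t)" and od: "\<not> even (2 * t + 1)" by simp_all
  show "slope (2 * t) = sign_at j"
    unfolding slope_def g_slope_def I_set_neg I_def[symmetric] Let_def div2 nth
      if_not_P[OF ne(1)] if_P[OF ev] by (rule sign)
  show "slope (2 * t + 1) = (if Suc j \<in> J then - 1 else 1) * sign_at j"
    unfolding slope_def g_slope_def I_set_neg I_def[symmetric] Let_def div2 nth
      if_not_P[OF ne(2)] if_not_P[OF od] sign[symmetric] by simp
qed

text \<open>The coordinates of \<rho> drop by one from each index to the next, so the pairing is the
  difference of the positions of \<open>y\<close> and \<open>x\<close> in the final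
  permutation.\<close>

lemma slope_end: "slope (2 * card I) = sign_at (length B)"
proof -
  let ?W = "W (length B)"
  have in_n: "inv ?W x \<in> {1..n}" "inv ?W y \<in> {1..n}" using xy inv_W_in by blast+
  have pairing: "coroot_pairing n (gamma_inf n B J) (x, y) = real (inv ?W y) - real (inv ?W x)"
    "coroot_pairing n (gamma_inf n B J) (y, x) = real (inv ?W x) - real (inv ?W y)"
    using xy in_n
    by (simp_all add: coroot_pairing_eq gamma_inf_def act_vec_def W_length[symmetric] rho_eq)
  have "slope (2 * card I) = sgn (real (inv ?W y) - real (inv ?W x))"
    unfolding slope_def g_slope_def I_set_neg I_def[symmetric] pairing by (simp add: sgn_real_def)
  then show ?thesis
    using inv_W_neq[of "length B"] by (auto simp: sign_at_def neg_def sgn_real_def)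
qed

lemma card_events_Suc:
  "card {e \<in> I. e \<le> Suc j} = card {e \<in> I. e \<le> j} + of_bool (Suc j \<in> I)"
proof -
  have "{e \<in> I. e \<le> Suc j} = {e \<in> I. e \<le> j} \<union> (if Suc j \<in> I then {Suc j} else {})"
    by (auto simp: le_Suc_eq)
  then show ?thesis by simp
qed

lemma g_half_Suc: "g_half (Suc t) = g_half t + slope t / 2"
  by (simp add: g_half_def field_simps)

text \<open>A crossing contributes two equal slopes, a folding two opposite ones.\<close>

lemma g_half_even: "j \<le> length B \<Longrightarrow> g_half (2 * card {e \<in> I. e \<le> j}) = H j - 1 / 2"
proof (induction j)
  case 0
  have "{e \<in> I. e \<le> 0} = {}" using I_subset by auto
  then have none: "card {e \<in> I. e \<le> 0} = 0" by (simp only: card.empty)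
  show ?case unfolding none by (simp add: g_half_def H_def neg_0)
next
  case (Suc j)
  let ?t = "card {e \<in> I. e \<le> j}"
  have j: "j < length B" using Suc.prems by simp
  have IH: "g_half (2 * ?t) = H j - 1 / 2" using Suc by simp
  show ?case
  proof (cases "Suc j \<in> I")
    case False
    then show ?thesis using IH idle_H[OF j] by (simp add: card_events_Suc)
  next
    case True
    have "g_half (2 * card {e \<in> I. e \<le> Suc j}) = g_half (2 * ?t) + (slope (2 * ?t) + slope (2 * ?t + 1)) / 2"
      using True by (simp add: card_events_Suc g_half_Suc)
    then show ?thesis
      using IH fold_H[OF j True] cross_H[OF j True] slope_event(1,2)[OF j True]
      by (auto simp: sign_at_def)
  qed
qed

lemma g_half_odd:
  assumes "j < length B" "Suc j \<in> I"
  shows "g_half (Suc (2 * card {e \<in> I. e \<le> j})) = U j"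
  using g_half_even[of j] slope_event(1)[OF assms] assms(1)
  by (simp add: g_half_Suc U_def sign_at_def)

lemma card_events_end: "card {e \<in> I. e \<le> length B} = card I"
proof -
  have "{e \<in> I. e \<le> length B} = I" using I_subset by auto
  then show ?thesis by simp
qed

lemma g_half_end: "g_half (Suc (2 * card I)) = U (length B)"
  using g_half_even[of "length B"] slope_end
  by (simp add: g_half_Suc U_def sign_at_def card_events_end)

lemma g_max_ge_H:
  assumes "j \<le> length B"
  shows "H j - 1 / 2 \<le> M"
proof -
  have "card {e \<in> I. e \<le> j} \<le> card I" by (intro card_mono finite_I) auto
  then show ?thesis using g_max_bounds(1)[of "2 * card {e \<in> I. e \<le> j}"] g_half_even[OF assms] by simp
qed

lemma g_max_ge_event:
  assumes "j < length B" "Suc j \<in> I"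
  shows "U j \<le> M"
  using g_max_bounds(1)[of "Suc (2 * card {e \<in> I. e \<le> j})"] g_half_odd[OF assms] slope_event(3)[OF assms]
  by simp

lemma g_max_ge_end: "U (length B) \<le> M"
  using g_max_bounds(1)[of "Suc (2 * card I)"] g_half_end by simp

lemma g_max_attained:
  "(\<exists>j\<le>length B. M = H j - 1 / 2) \<or> (\<exists>j<length B. Suc j \<in> I \<and> M = U j) \<or> M = U (length B)"
proof -
  \<comment> \<open>Each \<open>s < card I\<close> is the number of events before some event, so
    every breakpoint of \<open>g\<close> belongs to a position of the chain.\<close>
  have event: "\<exists>j<length B. Suc j \<in> I \<and> card {e \<in> I. e \<le> j} = s" if "s < card I" for s
  proof -
    let ?e = "sorted_list_of_set I ! s"
    have e: "?e \<in> I" using nth_mem[of s "sorted_list_of_set I"] that finite_I by simp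
    then have "?e \<in> {1..length B}" using I_subset by blast
    then obtain j where j: "?e = Suc j" "j < length B" by (cases ?e) auto
    then show ?thesis
      using card_less_nth_sorted_list_of_set[OF finite_I that] e
      by (intro exI[of _ j]) (simp add: less_Suc_eq_le)
  qed
  obtain t where t: "t \<le> Suc (2 * card I)" "M = g_half t"
    using g_max_bounds(2) by blast
  consider s where "t = 2 * s" | s where "t = Suc (2 * s)" by (metis evenE oddE Suc_eq_plus1)
  then show ?thesis
  proof cases
    case 1
    have "\<exists>j\<le>length B. card {e \<in> I. e \<le> j} = s"
    proof (cases "s = 0")
      case True
      have "{e \<in> I. e \<le> 0} = {}" using I_subset by auto
      then show ?thesis using True by (intro exI[of _ 0]) (simp only: card.empty le0)
    next
      case False
      then have "s - 1 < card I" using t(1) 1 by auto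
      then obtain j where "j < length B" "Suc j \<in> I" "card {e \<in> I. e \<le> j} = s - 1"
        using event by blast
      then show ?thesis using False by (intro exI[of _ "Suc j"]) (simp add: card_events_Suc)
    qed
    then show ?thesis using g_half_even t 1 by metis
  next
    case 2
    show ?thesis
    proof (cases "s = card I")
      case True
      then show ?thesis using t 2 g_half_end by simp
    next
      case False
      then have "s < card I" using t 2 by simp
      then obtain j where "j < length B" "Suc j \<in> I" "card {e \<in> I. e \<le> j} = s"
        using event by blast
      then have "j < length B \<and> Suc j \<in> I \<and> M = U j" using g_half_odd[of j] t 2 by simp
      then show ?thesis by blast
    qed
  qed
qed

end

sublocale alcove_path \<subseteq> folded_path_max "length B" H neg I J M
  using g_max_ge_H g_max_ge_event g_max_ge_end g_max_attained by unfold_locales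

section \<open>The crystal operator on admissible subsets\<close>

context alcove_path
begin

lemma alcove_f_None:
  "alcove_f n B (weight_vec n lam) i J = None \<longleftrightarrow> M \<le> of_bool (i = 0)"
  by (simp add: alcove_f_def alpha_eq Let_def not_less)

lemma h_le_M: "q \<le> N \<Longrightarrow> h q \<le> M"
  using U_le_M[of "P q"] U_P[of q] P_mono[of q N]
  unfolding P_N by simp

text \<open>
  The column \<open>q + 1\<close> is where \<open>h\<close> first attains its maximum; it contains the new folding \<open>a\<close>, and
  the old folding removed by \<open>f\<^sub>i\<close>, if any, is at the position \<open>e + 1\<close>.
\<close>

lemma alcove_f_Some:
  assumes M: "of_bool (i = 0) < M"
  obtains a e q where "alcove_f n B (weight_vec n lam) i J = Some (insert a (J - {Suc e}))"
    "a \<in> I" "a \<notin> J" "a \<le> e" "e \<le> length B" "e < length B \<Longrightarrow> Suc e \<in> I \<and> Suc e \<in> J"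
    "q < N" "P q < a" "a \<le> P (Suc q)" "P (Suc q) \<le> e" "\<And>q'. q' \<le> q \<Longrightarrow> h q' < M"
    "\<And>q'. P q' \<le> e \<Longrightarrow> q < q' \<Longrightarrow> q' \<le> N \<Longrightarrow> h q' = M"
proof -
  have M': "of_bool (neg 0) < M" using M by (simp add: neg_0)
  obtain a e where a: "a \<in> I" "a \<le> e" "e \<le> length B" and e: "e < length B \<Longrightarrow> Suc e \<in> I \<and> Suc e \<in> J"
    and Me: "M = U e" and before: "\<And>p. p \<in> I \<Longrightarrow> p \<le> e \<Longrightarrow> p \<le> a \<and> U (p - 1) < M"
    and aJ: "a \<notin> J" and Ua: "U (a - 1) = M - 1"
    and seg: "\<And>j. a \<le> j \<Longrightarrow> j \<le> e \<Longrightarrow> \<not> neg j \<and> U j = M" and less: "\<And>j. j < a \<Longrightarrow> U j < M"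
    by (rule folding_segment[OF M'], rule that) (assumption | simp)+
  have a': "a - 1 < length B" "a = Suc (a - 1)" using a I_subset by auto
  obtain q r where qr: "q < N" "r < length (col q)" "a - 1 = P q + r"
    using a'(1) by (rule position_cases)
  have hq: "h q = M - 1" using U_event[OF qr(1,2)] a a' Ua qr(3) by simp
  have aP: "P q < a" "a \<le> P (Suc q)" using qr a' by (auto simp: P_Suc)
  \<comment> \<open>If \<open>e\<close> came before the end of the column of \<open>a\<close>, its
    half step would have height \<open>h q = M - 1\<close> as well.\<close>
  have Pe: "P (Suc q) \<le> e"
  proof (rule ccontr)
    assume "\<not> P (Suc q) \<le> e"
    then have e': "e - P q < length (col q)" "P q + (e - P q) = e"
      using aP a by (auto simp: P_Suc)
    then have "e < length B" using B_nth(2)[OF qr(1) e'(1)] by simp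
    then have "U e = h q" using U_event[OF qr(1) e'(1)] e e'(2) by simp
    then show False using Me hq by simp
  qed
  let ?m = "if e < length B then enat (Suc e) else \<infinity>"
  have enat_value: "of_int (sgn_root n (x, y)) * level_Delta_hat n B (weight_vec n lam) J (x, y) (enat p) = real_of_int (U (p - 1))"
    if "p \<in> I" for p
    using level_Delta_event[OF that] by (simp add: level_Delta_hat_def flip: of_int_mult)
  have m: "(LEAST j. j \<in> I_hat B J (x, y) \<and>
      of_int (sgn_root n (x, y)) * level_Delta_hat n B (weight_vec n lam) J (x, y) j = M) = ?m"
  proof (rule Least_equality)
    show "?m \<in> I_hat B J (x, y) \<and>
        of_int (sgn_root n (x, y)) * level_Delta_hat n B (weight_vec n lam) J (x, y) ?m = M"
    proof (cases "e < length B")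
      case True
      then show ?thesis using e Me enat_value[of "Suc e"] by (simp add: I_hat_def I_def[symmetric])
    next
      case False
      then show ?thesis using Me a level_Delta_end by (simp add: I_hat_def)
    qed
  next
    fix j assume j: "j \<in> I_hat B J (x, y) \<and>
        of_int (sgn_root n (x, y)) * level_Delta_hat n B (weight_vec n lam) J (x, y) j = M"
    show "?m \<le> j"
    proof (cases j)
      case (enat p)
      then have p: "p \<in> I" using j by (auto simp: I_hat_def I_def)
      then have "U (p - 1) = M" using j enat enat_value by simp
      then have "Suc e \<le> p" using before[OF p] by force
      moreover have "p \<le> length B" using p I_subset by auto
      ultimately show ?thesis using enat by simp
    qed simp
  qed
  have "{j \<in> I_set B J (x, y). enat j < ?m} = {j \<in> I. j \<le> e}"
    using I_subset a(3) by (auto simp: I_def[symmetric] less_Suc_eq_le)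
  then have k: "Max {j \<in> I_set B J (x, y). enat j < ?m} = a"
    using a before by (auto intro!: Max_eqI)
  have "{j \<in> J. enat j \<noteq> ?m} \<union> {a} = insert a (J - {Suc e})"
    using J a(3) by auto
  then have f: "alcove_f n B (weight_vec n lam) i J = Some (insert a (J - {Suc e}))"
    using M unfolding alcove_f_def alpha_eq Let_def m k by simp
  show ?thesis
  proof (rule that[OF f a(1) aJ a(2,3) e qr(1) aP Pe])
    show "h q' < M" if "q' \<le> q" for q'
      using less[of "P q'"] U_P[of q'] P_mono[OF that] aP qr(1) that by simp
    show "h q' = M" if "P q' \<le> e" "q < q'" "q' \<le> N" for q'
      using seg[of "P q'"] U_P[of q'] P_mono[of "Suc q" q'] aP that by simp
  qed
qed

section \<open>Signatures of columns\<close>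

lemma filter_sorted_list_of_set:
  "finite D \<Longrightarrow> filter Q (sorted_list_of_set D) = sorted_list_of_set {d \<in> D. Q d}" for D :: "nat set"
  by (intro sorted_list_of_set_eqI[symmetric]) (auto simp: sorted_wrt_filter)

definition column_signature :: "nat \<Rightarrow> (sign \<times> nat) list" where
  "column_signature q = map (\<lambda>a. (if a = x then Plus else Minus, q))
    (filter (\<lambda>a. a \<in> {x, y}) (column_word i (sorted_list_of_set (C (Suc q)))))"

definition column_sign :: "nat \<Rightarrow> int" where
  "column_sign q = of_bool (x \<in> C (Suc q)) - of_bool (y \<in> C (Suc q))"

text \<open>In every case \<open>y\<close> is read before \<open>x\<close>: larger letters come
  first if \<open>y = Suc x\<close>, and for \<open>i = 0\<close> the letter 1 is moved to the
  front.\<close>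

lemma column_signature_cases:
  "column_signature q = [(Plus, q)] \<and> column_sign q = 1 \<or>
   column_signature q = [(Minus, q)] \<and> column_sign q = - 1 \<or>
   (column_signature q = [] \<or> column_signature q = [(Minus, q), (Plus, q)]) \<and> column_sign q = 0"
proof -
  let ?C = "C (Suc q)"
  have word: "filter (\<lambda>a. a \<in> {x, y}) (column_word i (sorted_list_of_set ?C)) =
      (if y \<in> ?C then [y] else []) @ (if x \<in> ?C then [x] else [])"
  proof (cases "i = 0")
    case True
    then have y: "y = 1" by (simp add: minus_letter_def)
    have sets: "{a \<in> {a \<in> ?C. a = 1}. a \<in> {x, y}} = (if y \<in> ?C then {y} else {})"
      "{a \<in> {a \<in> ?C. a \<noteq> 1}. a \<in> {x, y}} = (if x \<in> ?C then {x} else {})"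
      using xy(1) y by auto
    have fin: "finite {a \<in> ?C. Q a}" for Q
      using finite_C by simp
    show ?thesis
      unfolding column_word_def if_P[OF True] filter_append rev_filter[symmetric]
        filter_sorted_list_of_set[OF finite_C] filter_sorted_list_of_set[OF fin] sets by simp
  next
    case False
    then have x: "y = Suc x" by (simp add: minus_letter_def plus_letter_def)
    have 1: "{a \<in> ?C. a = x \<or> a = y} = (if x \<in> ?C then {x} else {}) \<union> (if y \<in> ?C then {y} else {})"
      by auto
    have 2: "sorted_list_of_set ((if x \<in> ?C then {x} else {}) \<union> (if y \<in> ?C then {y} else {})) =
        (if x \<in> ?C then [x] else []) @ (if y \<in> ?C then [y] else [])"
      by (intro sorted_list_of_set_eqI) (auto simp: x)
    show ?thesis
      using False by (simp add: column_word_def rev_filter[symmetric] filter_sorted_list_of_set finite_C 1 2)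
  qed
  show ?thesis
    unfolding column_signature_def word column_sign_def using xy(1) by auto
qed

lemma signature_word_eq:
  "signature_word n i (sfill n lam J) = concat (map column_signature [0..<N])"
  unfolding signature_word_def length_sfill
  by (intro arg_cong[of _ _ concat] map_cong) (simp_all add: column_signature_def sfill_nth)

lemma h_eq: "h q = (\<Sum>p<q. column_sign p)"
  by (induction q) (simp_all add: h_def K_Suc column_sign_def, simp add: K_def)

text \<open>The partial sums of the column signs are \<open>h\<close>, so the signature rule yields
  its maximum and the first column attaining it.\<close>

lemma KR_phi_eq:
  "q \<le> N \<Longrightarrow> h q \<le> KR_phi n i (sfill n lam J)"
  "\<exists>q\<le>N. h q = KR_phi n i (sfill n lam J)"
  "q < N \<Longrightarrow> h (Suc q) = KR_phi n i (sfill n lam J) \<Longrightarrow>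
    (\<And>q'. q' \<le> q \<Longrightarrow> h q' < KR_phi n i (sfill n lam J)) \<Longrightarrow>
    snd (last (remaining_plus n i (sfill n lam J))) = q"
proof -
  let ?R = "remaining_plus n i (sfill n lam J)"
  have R: "?R = plusses (reduced_word (concat (map column_signature [0..<N])))"
    by (simp add: remaining_plus_def plusses_def signature_word_eq)
  have S: "sum_list (map column_sign (take q [0..<N])) = h q" if "q \<le> N" for q
    using that by (simp add: h_eq sum_list_distinct_conv_sum_set atLeast0LessThan)
  let ?S = "\<lambda>r. sum_list (map column_sign (take r [0..<N]))"
  have *: "(\<forall>r\<le>N. ?S r \<le> length ?R) \<and> (\<exists>r\<le>N. ?S r = length ?R) \<and>
    (\<forall>r<N. ?S (Suc r) = length ?R \<longrightarrow> (\<forall>r'\<le>r. ?S r' < length ?R) \<longrightarrow>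
      ?R \<noteq> [] \<and> snd (last ?R) = [0..<N] ! r)"
    using plusses_reduced_word_concat[of "[0..<N]" column_signature column_sign, OF column_signature_cases]
    unfolding R length_upt diff_zero .
  have main: "(\<forall>r\<le>N. h r \<le> length ?R) \<and> (\<exists>r\<le>N. h r = length ?R) \<and>
    (\<forall>r<N. h (Suc r) = length ?R \<longrightarrow> (\<forall>r'\<le>r. h r' < length ?R) \<longrightarrow> ?R \<noteq> [] \<and> snd (last ?R) = r)"
  proof (intro conjI allI impI)
    fix r assume "r \<le> N"
    then show "h r \<le> length ?R" using * S by metis
  next
    show "\<exists>r\<le>N. h r = length ?R" using * S by metis
  next
    fix r assume r: "r < N" "h (Suc r) = length ?R" "\<forall>r'\<le>r. h r' < length ?R"
    have "?S (Suc r) = length ?R" using S[of "Suc r"] r by simp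
    moreover have "\<forall>r'\<le>r. ?S r' < length ?R" using S r by simp
    ultimately have "?R \<noteq> [] \<and> snd (last ?R) = [0..<N] ! r" using * r(1) by blast
    then show "?R \<noteq> []" "snd (last ?R) = r" using r(1) by simp_all
  qed
  then show "q \<le> N \<Longrightarrow> h q \<le> KR_phi n i (sfill n lam J)"
    "\<exists>q\<le>N. h q = KR_phi n i (sfill n lam J)"
    "q < N \<Longrightarrow> h (Suc q) = KR_phi n i (sfill n lam J) \<Longrightarrow>
    (\<And>q'. q' \<le> q \<Longrightarrow> h q' < KR_phi n i (sfill n lam J)) \<Longrightarrow> snd (last ?R) = q"
    by (auto simp: KR_phi_def)
qed

section \<open>Crystal operators\<close>

lemma transpose_comp_W:
  "Transposition.transpose x y \<circ> W j = W j \<circ> Transposition.transpose (inv (W j) x) (inv (W j) y)"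
  by (auto simp: fun_eq_iff transpose_def W_inv W_eq_iff)

text \<open>As \<gamma> is plus or minus \<alpha>, the reflection acts from the left as the
  transposition of the letters \<open>x\<close> and \<open>y\<close>.\<close>

lemma refl_perm_event:
  assumes "j < length B" "Suc j \<in> I"
  shows "W j \<circ> refl_perm (B ! j) = Transposition.transpose x y \<circ> W j"
proof -
  have "refl_perm (B ! j) = Transposition.transpose (inv (W j) x) (inv (W j) y)"
    using event_cases[OF assms] by (auto simp: refl_perm_def transpose_commute)
  then show ?thesis by (simp only: transpose_comp_W)
qed

text \<open>The new folding at \<open>a\<close> multiplies the later permutations on the left by the
  transposition of \<open>x\<close> and \<open>y\<close>, and omitting the old one at
  \<open>e + 1\<close> cancels this. If \<open>e = length B\<close>, the factor stays to the
  end.\<close>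

lemma W_moved_folding:
  assumes a: "a \<in> I" "a \<notin> J" "a \<le> e" and e: "e < length B \<Longrightarrow> Suc e \<in> I \<and> Suc e \<in> J"
  defines "J' \<equiv> insert a (J - {Suc e})"
  shows "j \<le> length B \<Longrightarrow> chain_subset.W B J' j =
    (if a \<le> j \<and> j \<le> e then Transposition.transpose x y \<circ> W j else W j)"
proof -
  have "J' \<subseteq> {1..length B}" using J a(1) I_subset by (auto simp: J'_def)
  then interpret F: gamma_chain n lam J' using n lam by unfold_locales
  have swap2: "Transposition.transpose x y \<circ> (Transposition.transpose x y \<circ> f) = f" for f
    by (auto simp: fun_eq_iff)
  show "F.W j = (if a \<le> j \<and> j \<le> e then Transposition.transpose x y \<circ> W j else W j)"
    if "j \<le> length B"
    using that
  proof (induction j)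
    case 0
    have "a \<noteq> 0" using a I_subset by auto
    then show ?case by (simp add: F.W_0 W_0)
  next
    case (Suc j)
    have j: "j < length B" using Suc.prems by simp
    have IH: "F.W j = (if a \<le> j \<and> j \<le> e then Transposition.transpose x y \<circ> W j else W j)"
      using Suc by simp
    consider "Suc j = a" | "Suc j = Suc e" | "Suc j \<noteq> a" "Suc j \<noteq> Suc e" by blast
    then show ?case
    proof cases
      case 1
      then have "Suc j \<in> J'" "Suc j \<notin> J" using a by (auto simp: J'_def)
      then have "F.W (Suc j) = W j \<circ> refl_perm (B ! j)" "W (Suc j) = W j"
        using IH unfolding F.W_Suc W_Suc by (simp_all add: 1[symmetric])
      then show ?thesis using refl_perm_event[OF j] 1 a by simp
    next
      case 2
      then have "Suc j \<notin> J'" "Suc j \<in> J" using a e j by (auto simp: J'_def)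
      then have "F.W (Suc j) = Transposition.transpose x y \<circ> W j"
        "W (Suc j) = W j \<circ> refl_perm (B ! j)"
        using IH 2 a by (simp_all add: F.W_Suc W_Suc)
      then show ?thesis using refl_perm_event[OF j] 2 e j by simp
    next
      case 3
      have "Suc j \<in> J' \<longleftrightarrow> Suc j \<in> J" "a \<le> Suc j \<and> Suc j \<le> e \<longleftrightarrow> a \<le> j \<and> j \<le> e"
        using 3 a(3) by (auto simp: J'_def)
      then show ?thesis using IH by (auto simp: F.W_Suc W_Suc fun_eq_iff)
    qed
  qed
qed

lemma KR_f_sfill:
  assumes M: "of_bool (i = 0) < M"
  shows "M = KR_phi n i (sfill n lam J)"
    and "\<exists>J'. alcove_f n B (weight_vec n lam) i J = Some J' \<and>
      KR_f n i (sfill n lam J) = Some (sfill n lam J')"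
proof -
  let ?b = "sfill n lam J"
  obtain a e q where f: "alcove_f n B (weight_vec n lam) i J = Some (insert a (J - {Suc e}))"
    and a: "a \<in> I" "a \<notin> J" "a \<le> e" and e: "e \<le> length B" "e < length B \<Longrightarrow> Suc e \<in> I \<and> Suc e \<in> J"
    and q: "q < N" and Pq: "P q < a" "a \<le> P (Suc q)" "P (Suc q) \<le> e"
    and less: "\<And>q'. q' \<le> q \<Longrightarrow> h q' < M"
    and eq: "\<And>q'. P q' \<le> e \<Longrightarrow> q < q' \<Longrightarrow> q' \<le> N \<Longrightarrow> h q' = M"
    by (rule alcove_f_Some[OF M], rule that) (assumption | simp)+
  define J' where "J' = insert a (J - {Suc e})"
  have "J' \<subseteq> {1..length B}" using J a(1) I_subset by (auto simp: J'_def)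
  then interpret F: gamma_chain n lam J' using n lam by unfold_locales
  have hq: "h (Suc q) = M" using eq[of "Suc q"] Pq q by simp
  show phi: "M = KR_phi n i ?b"
  proof (rule antisym)
    show "M \<le> KR_phi n i ?b" using KR_phi_eq(1)[of "Suc q"] q hq by simp
    show "KR_phi n i ?b \<le> M" using KR_phi_eq(2) h_le_M by (metis of_int_of_nat_eq)
  qed
  have last: "snd (last (remaining_plus n i ?b)) = q"
  proof (rule KR_phi_eq(3)[OF q])
    show "h (Suc q) = KR_phi n i ?b" using hq phi by simp
    show "h q' < KR_phi n i ?b" if "q' \<le> q" for q' using less[OF that] phi by simp
  qed
  have h_step: "h (Suc p) = h p + column_sign p" for p by (simp add: h_eq)
  have C': "F.C (Suc p) = (if a \<le> P (Suc p) \<and> P (Suc p) \<le> e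
      then Transposition.transpose x y ` C (Suc p) else C (Suc p))" if "p < N" for p
  proof -
    have "P (Suc p) \<le> length B" using P_mono[of "Suc p" N] that unfolding P_N by simp
    from W_moved_folding[OF a e(2) this, folded J'_def] show ?thesis
      by (simp add: F.C_def C_def image_comp)
  qed
  \<comment> \<open>In the affected columns after column \<open>q + 1\<close> the height
    \<open>h\<close> stays at \<open>M\<close>, so each contains both letters or neither and the
    exchange preserves its set.\<close>
  have other: "F.C (Suc p) = C (Suc p)" if p: "p < N" "p \<noteq> q" for p
  proof (cases "a \<le> P (Suc p) \<and> P (Suc p) \<le> e")
    case True
    have "q < p"
    proof (rule ccontr)
      assume "\<not> q < p"
      then have "P (Suc p) \<le> P q" using p by (intro P_mono) simp
      then show False using True Pq by simp
    qed
    moreover have "P p \<le> P (Suc p)" by (simp add: P_Suc)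
    ultimately have "h p = M" "h (Suc p) = M" using eq[of p] eq[of "Suc p"] True p by simp_all
    then have "x \<in> C (Suc p) \<longleftrightarrow> y \<in> C (Suc p)"
      using h_step[of p] by (auto simp: column_sign_def)
    then show ?thesis using C'[OF p(1)] True by (simp add: transpose_image_eq)
  next
    case False
    then show ?thesis unfolding C'[OF p(1)] by (rule if_not_P)
  qed
  let ?c = "map (\<lambda>a. if a = x then y else a) (?b ! q)"
  \<comment> \<open>Since \<open>h\<close> rises in this column, it contains \<open>x\<close>
    without \<open>y\<close>.\<close>
  have sign: "x \<in> C (Suc q)" "y \<notin> C (Suc q)"
    using h_step[of q] less[of q] hq
    by (cases "x \<in> C (Suc q)"; cases "y \<in> C (Suc q)"; simp add: column_sign_def)+
  have b_q: "?b ! q = sorted_list_of_set (C (Suc q))" by (rule sfill_nth[OF q])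
  have C'_q: "F.C (Suc q) = (\<lambda>a. if a = x then y else a) ` C (Suc q)"
    unfolding C'[OF q] using Pq sign by (auto simp: transpose_def image_iff)
  have sort_c: "sort ?c = sorted_list_of_set (F.C (Suc q))"
  proof (rule sorted_list_of_set_eqI[symmetric])
    show "distinct (sort ?c)"
      using sign by (auto simp: b_q distinct_map inj_on_def finite_C)
    show "set (sort ?c) = F.C (Suc q)" by (simp add: b_q C'_q finite_C)
  qed simp
  have c: "(if i = 0 then sort ?c else ?c) = sorted_list_of_set (F.C (Suc q))"
  proof (cases "i = 0")
    case True
    then show ?thesis using sort_c by simp
  next
    case False
    then have y: "y = Suc x" by (simp add: minus_letter_def plus_letter_def)
    have "sorted ?c"
      unfolding sorted_map b_q
    proof (rule sorted_wrt_mono_rel[OF _ sorted_sorted_list_of_set])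
      fix u v assume "u \<in> set (sorted_list_of_set (C (Suc q)))" "v \<in> set (sorted_list_of_set (C (Suc q)))"
        and "u \<le> v"
      moreover from this have "v \<noteq> Suc x" using sign y by (auto simp: finite_C)
      ultimately show "(if u = x then y else u) \<le> (if v = x then y else v)" using y by auto
    qed
    then show ?thesis using False sort_c by (simp add: sorted_sort_id)
  qed
  have "KR_phi n i ?b \<noteq> 0" using phi M by (cases "i = 0") auto
  then have "KR_f n i ?b = Some (?b[q := sorted_list_of_set (F.C (Suc q))])"
    using c last by (simp add: KR_f_def Let_def)
  also have "?b[q := sorted_list_of_set (F.C (Suc q))] = sfill n lam J'"
  proof (rule nth_equalityI)
    fix p assume "p < length (?b[q := sorted_list_of_set (F.C (Suc q))])"
    then have p: "p < N" by (simp add: length_sfill)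
    then show "?b[q := sorted_list_of_set (F.C (Suc q))] ! p = sfill n lam J' ! p"
      using F.sfill_nth[OF p] sfill_nth[OF p] other[OF p]
      by (cases "p = q") (simp_all add: length_sfill)
  qed (simp add: length_sfill F.length_sfill)
  finally show "\<exists>J'. alcove_f n B (weight_vec n lam) i J = Some J' \<and>
      KR_f n i ?b = Some (sfill n lam J')"
    using f by (auto simp: J'_def)
qed

text \<open>\<open>KR_phi\<close> is always at most \<open>M\<close>, and equal to it once
  \<open>M\<close> exceeds the threshold, which gives both directions. For \<open>i = 0\<close> the
  condition \<open>KR_phi n 0 b \<ge> 2\<close> is the threshold 1.\<close>

lemma dual_Demazure_arrow_iff:
  "(\<exists>c. dual_Demazure_arrow n lam i (sfill n lam J) c) \<longleftrightarrow> of_bool (i = 0) < M"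
proof -
  let ?phi = "KR_phi n i (sfill n lam J)"
  have "(\<exists>c. dual_Demazure_arrow n lam i (sfill n lam J) c) \<longleftrightarrow> of_bool (i = 0) < real ?phi"
    using sfill_KR by (auto simp: dual_Demazure_arrow_def KR_f_def Let_def)
  also have "\<dots> \<longleftrightarrow> of_bool (i = 0) < M"
  proof
    assume "of_bool (i = 0) < real ?phi"
    moreover have "real ?phi \<le> M" using KR_phi_eq(2) h_le_M by (metis of_int_of_nat_eq)
    ultimately show "of_bool (i = 0) < M" by simp
  qed (use KR_f_sfill(1) in simp)
  finally show ?thesis .
qed

end

theorem theorem4p7:
  fixes n i :: nat and lam :: "nat \<Rightarrow> nat" and J :: "nat set" and b :: filling
  assumes "n \<ge> 2"
    and "partition_below n lam"
    and "J \<in> admissible n (Gamma n lam)"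
    and "b = sfill n lam J"
    and "i \<in> {0..n - 1}"
  shows "((\<exists>c. dual_Demazure_arrow n lam i b c) \<longleftrightarrow>
            alcove_f n (Gamma n lam) (weight_vec n lam) i J \<noteq> None) \<and>
         (\<forall>J'. alcove_f n (Gamma n lam) (weight_vec n lam) i J = Some J' \<longrightarrow>
            KR_f n i b = Some (sfill n lam J'))"
proof -
  interpret alcove_path n lam J i
    using assms by unfold_locales (auto simp: admissible_def)
  have iff: "alcove_f n B (weight_vec n lam) i J \<noteq> None \<longleftrightarrow> of_bool (i = 0) < M"
    using alcove_f_None by (simp add: not_le)
  then show ?thesis
    using KR_f_sfill(2) unfolding assms(4) dual_Demazure_arrow_iff by force
qed

end
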